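(* Suppose $G$ is a completely metrisable topological group admitting a minimal metric and that, for every open $W\ni 1$, the set $\{g^2 \mid g\in W\}$ is dense in a neighbourhood of $1$ (i.e., its closure contains a neighbourhood of $1$). Then there are open sets $\mathcal U\supseteq\mathcal O\ni 1$ in $G$ so that, for every $f\in\mathcal O$, there is a unique one-parameter subgroup $(h^\alpha)_{\alpha\in\mathbb R}$ of $G$ with $h^1=f$ and $h^\alpha\in\mathcal U$ for all $\alpha\in[-1,1]$.
   Context: $1$ denotes the identity element of $G$. A topological group is completely metrisable if its topology is induced by some complete metric. A metric on $G$ is compatible if it induces the topology of $G$, and left-invariant if $d(hg,hf)=d(g,f)$ for all $g,f,h\in G$. A metric $d$ on $G$ is minimal if it is compatible, left-invariant and, for every other compatible left-invariant metric $\partial$ on $G$, there are an identity neighbourhood $U$ and a constant $K$ (possibly depending on $\partial$) so that $d(g,f)\leqslant K\cdot\partial(g,f)$ for all $g,f\in U$. A one-parameter subgroup $(h^\alpha)_{\alpha\in\mathbb R}$ of $G$ is a continuous group homomorphism $\alpha\in(\mathbb R,+)\mapsto h^\alpha\in G$. *)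

theory Defs
  imports "HOL-Analysis.Analysis"
begin

text \<open>
  Topological groups are rendered by the type class \<^class>\<open>topological_group_add\<close>. It does
  not assume commutativity: the group law is written additively only because the library has
  no multiplicative counterpart. Thus the product of g and f is \<open>g + f\<close>, the identity
  element is \<open>0\<close>, and the square of g is \<open>g + g\<close>. No separation axiom is built in.
\<close>

definition compatible_metric :: "('a::topological_space \<Rightarrow> 'a \<Rightarrow> real) \<Rightarrow> bool" where
  "compatible_metric d \<longleftrightarrow>
     Metric_space UNIV d \<and> Metric_space.mtopology UNIV d = euclidean"

definition left_invariant :: "('a::group_add \<Rightarrow> 'a \<Rightarrow> real) \<Rightarrow> bool" where
  "left_invariant d \<longleftrightarrow> (\<forall>g f h. d (h + g) (h + f) = d g f)"

definition minimal_metric :: "('a::topological_group_add \<Rightarrow> 'a \<Rightarrow> real) \<Rightarrow> bool" where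
  "minimal_metric d \<longleftrightarrow>
     compatible_metric d \<and> left_invariant d \<and>
     (\<forall>e. compatible_metric e \<and> left_invariant e \<longrightarrow>
        (\<exists>U K. 0 \<in> interior U \<and> (\<forall>g\<in>U. \<forall>f\<in>U. d g f \<le> K * e g f)))"

definition one_parameter_subgroup :: "(real \<Rightarrow> 'a::topological_group_add) \<Rightarrow> bool" where
  "one_parameter_subgroup h \<longleftrightarrow>
     continuous_on UNIV h \<and> (\<forall>a b. h (a + b) = h a + h b)"

end

theory Submission
  imports Defs
begin

text \<open>
  Let \<open>d\<close> be a minimal metric and \<open>N x = d 0 x\<close>. The proof rests on one consequence of
  minimality, the escape property: there are \<open>r > 0\<close> and \<open>K\<close> such that \<open>n N(g) \<le> K\<close> whenever
  \<open>g, 2 g, \<dots>, n g\<close> all lie in the ball of radius \<open>r\<close>. If it failed, a Birkhoff--Kakutani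
  construction along a chain of neighbourhoods containing suitable segments \<open>{j g}\<close> would give a
  compatible left-invariant metric of which no multiple dominates \<open>d\<close> near the identity
  (\<open>exists_incomparable_norm\<close>, \<open>minimal_metric_imp_gleason_norm\<close>).

  The escape property implies that multiples grow linearly, \<open>n N(g) \<le> C N(n g)\<close> as long as they
  stay small (\<open>linear_growth\<close>), and that conjugation by small elements is uniformly Lipschitz
  (\<open>conj_le\<close>). Together they show that \<open>g \<mapsto> g + g\<close> is injective near the identity, with a
  Lipschitz inverse on its image (\<open>doubling_inverse_Lipschitz\<close>).

  Since doubles are dense near the identity, a small \<open>f\<close> is a limit of doubles \<open>X n + X n\<close>, and
  then \<open>X\<close> is left Cauchy. By the conjugation estimate it is Cauchy on both sides, so it converges
  in a completely metrisable group (\<open>two_sided_Cauchy_convergent\<close>), and \<open>f\<close> has a small half.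
  Iterating gives roots \<open>y n\<close> with \<open>2 ^ n y n = f\<close> whose norms decay like \<open>1 / 2 ^ n\<close> by linear
  growth. They define a Lipschitz homomorphism on the dyadic rationals, which extends to the reals.
  Uniqueness follows from local injectivity of doubling: two such subgroups agree at \<open>1 / 2 ^ n\<close>
  for all \<open>n\<close>, hence on dyadic rationals, hence everywhere.
\<close>


section \<open>Multiples in a noncommutative additive group\<close>

lemmas group_expand = add.assoc minus_add diff_conv_add_uminus

text \<open>
  The additively written powers of \<open>x\<close>: \<open>nmult n x\<close> for natural exponents and \<open>imult k x\<close>
  for integer exponents.
\<close>

primrec nmult :: "nat \<Rightarrow> 'a::group_add \<Rightarrow> 'a" where
  "nmult 0 x = 0"
| "nmult (Suc n) x = nmult n x + x"

definition imult :: "int \<Rightarrow> 'a::group_add \<Rightarrow> 'a" where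
  "imult k x = (if 0 \<le> k then nmult (nat k) x else - nmult (nat (- k)) x)"

lemma nmult_1 [simp]: "nmult (Suc 0) x = x"
  by simp

lemma nmult_add: "nmult (m + n) x = nmult m x + nmult n x"
  by (induction n) (auto simp: add.assoc)

lemma nmult_Suc_left: "nmult (Suc n) x = x + nmult n x"
  using nmult_add[of "Suc 0" n x] by simp

lemma nmult_nmult: "nmult (m * n) x = nmult m (nmult n x)"
proof (induction m)
  case (Suc m)
  have "nmult (Suc m * n) x = nmult (m * n + n) x" by (simp add: add.commute)
  then show ?case using Suc by (simp only: nmult_add nmult.simps)
qed simp

lemma nmult_double: "nmult (2 * n) x = nmult n (x + x)"
  using nmult_nmult[of n 2 x] by (simp add: numeral_2_eq_2 mult.commute)

lemma nmult_conj: "nmult n (- g + x + g) = - g + nmult n x + g"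
  by (induction n) (simp_all add: group_expand del: add_uminus_conv_diff)

lemma imult_0 [simp]: "imult 0 x = 0"
  by (simp add: imult_def)

lemma imult_int [simp]: "imult (int n) x = nmult n x"
  by (simp add: imult_def)

lemma imult_uminus: "imult (- k) x = - imult k x"
  by (auto simp: imult_def)

lemma imult_plus_1: "imult (k + 1) x = imult k x + x"
proof (cases "0 \<le> k")
  case True
  then show ?thesis by (simp add: imult_def nat_add_distrib)
next
  case False
  define n where "n = nat (- (k + 1))"
  have n: "nat (- k) = Suc n" "k + 1 = - int n" using False by (auto simp: n_def)
  have "imult (k + 1) x = - nmult n x" by (simp add: n(2) imult_uminus)
  moreover have "imult k x = - (x + nmult n x)"
    using False n(1) by (simp add: imult_def nmult_Suc_left del: nmult.simps(2))
  ultimately show ?thesis by (simp add: group_expand del: add_uminus_conv_diff)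
qed

lemma imult_minus_1: "imult (k - 1) x = imult k x - x"
  using imult_plus_1[of "k - 1" x] by simp

lemma imult_add: "imult (j + k) x = imult j x + imult k x"
proof (induction k rule: int_induct[where k = 0])
  case (step1 i)
  then show ?case using imult_plus_1[of "j + i" x] imult_plus_1[of i x]
    by (simp add: add.assoc)
next
  case (step2 i)
  then show ?case using imult_minus_1[of "j + i" x] imult_minus_1[of i x]
    by (simp add: group_expand del: add_uminus_conv_diff)
qed simp

lemma imult_double: "imult (2 * k) x = imult k (x + x)"
proof -
  have "nmult (nat (2 * k)) x = nmult (nat k) (x + x)"
    using nmult_double[of "nat k" x] by (simp add: nat_mult_distrib)
  moreover have "nmult (nat (- (2 * k))) x = nmult (nat (- k)) (x + x)"
    using nmult_double[of "nat (- k)" x] nat_mult_distrib[of 2 "- k"] by simp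
  ultimately show ?thesis by (simp add: imult_def)
qed


section \<open>Norms on topological groups\<close>

text \<open>
  A compatible left-invariant metric \<open>d\<close> is encoded by the length function \<open>N x = d 0 x\<close>, from
  which it is recovered as \<open>d g f = N (- g + f)\<close>.
\<close>

locale group_norm =
  fixes N :: "'a::topological_group_add \<Rightarrow> real"
  assumes zero_iff: "N x = 0 \<longleftrightarrow> x = 0"
    and norm_uminus: "N (- x) = N x"
    and triangle: "N (x + y) \<le> N x + N y"
    and open_iff: "open S \<longleftrightarrow> (\<forall>x\<in>S. \<exists>r>0. \<forall>y. N (- x + y) < r \<longrightarrow> y \<in> S)"
begin

lemma zero [simp]: "N 0 = 0"
  by (simp add: zero_iff)

lemma nonneg [simp]: "0 \<le> N x"
  using triangle[of x "- x"] norm_uminus[of x] by simp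

lemma norm_diff_commute: "N (x - y) = N (y - x)"
  using norm_uminus[of "x - y"] by simp

lemma norm_diff_commute': "N (- x + y) = N (- y + x)"
  using norm_uminus[of "- x + y"] by (simp add: minus_add)

lemma triangle3: "N (x + y + z) \<le> N x + N y + N z"
  using triangle[of "x + y" z] triangle[of x y] by linarith

lemma triangle_diff: "N (- x + z) \<le> N (- x + y) + N (- y + z)"
  using triangle[of "- x + y" "- y + z"] by (simp add: group_expand del: add_uminus_conv_diff)

lemma nmult_le: "N (nmult n x) \<le> real n * N x"
proof (induction n)
  case (Suc n)
  then show ?case using triangle[of "nmult n x" x] by (simp add: algebra_simps)
qed simp

lemma imult_le: "N (imult k x) \<le> \<bar>real_of_int k\<bar> * N x"
  using nmult_le[of "nat k" x] nmult_le[of "nat (- k)" x] by (auto simp: imult_def norm_uminus)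

lemma open_ball: "open {y. N (- x + y) < r}"
  unfolding open_iff Ball_def mem_Collect_eq
proof (intro allI impI)
  fix y assume y: "N (- x + y) < r"
  have "N (- x + z) < r" if "N (- y + z) < r - N (- x + y)" for z
    using that triangle_diff[of x z y] by linarith
  then show "\<exists>s>0. \<forall>z. N (- y + z) < s \<longrightarrow> N (- x + z) < r"
    using y by (intro exI[of _ "r - N (- x + y)"]) auto
qed

lemma open_ball0: "open {y. N y < r}"
  using open_ball[of 0 r] by simp

lemma open_contains_ball:
  assumes "open S" "x \<in> S"
  obtains r where "0 < r" "\<And>y. N (- x + y) < r \<Longrightarrow> y \<in> S"
  using assms unfolding open_iff by blast

lemma tendsto_iff: "(f \<longlongrightarrow> l) F \<longleftrightarrow> (\<forall>e>0. \<forall>\<^sub>F i in F. N (- l + f i) < e)"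
proof
  assume l: "(f \<longlongrightarrow> l) F"
  show "\<forall>e>0. \<forall>\<^sub>F i in F. N (- l + f i) < e"
  proof safe
    fix e :: real assume "e > 0"
    then show "\<forall>\<^sub>F i in F. N (- l + f i) < e"
      using topological_tendstoD[OF l open_ball[of l e]] by simp
  qed
next
  assume R: "\<forall>e>0. \<forall>\<^sub>F i in F. N (- l + f i) < e"
  show "(f \<longlongrightarrow> l) F"
  proof (rule topological_tendstoI)
    fix S assume "open S" "l \<in> S"
    then obtain r where r: "0 < r" "\<And>y. N (- l + y) < r \<Longrightarrow> y \<in> S"
      using open_contains_ball by metis
    then have "\<forall>\<^sub>F i in F. N (- l + f i) < r" using R by blast
    then show "\<forall>\<^sub>F i in F. f i \<in> S" by eventually_elim (rule r)
  qed
qed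

lemma tendsto_norm:
  assumes "(f \<longlongrightarrow> l) F"
  shows "((\<lambda>i. N (f i)) \<longlongrightarrow> N l) F"
proof (rule tendstoI)
  fix e :: real assume "e > 0"
  then have "\<forall>\<^sub>F i in F. N (- l + f i) < e" using assms unfolding tendsto_iff by blast
  then show "\<forall>\<^sub>F i in F. dist (N (f i)) (N l) < e"
  proof eventually_elim
    fix i assume "N (- l + f i) < e"
    then show "dist (N (f i)) (N l) < e"
      using triangle[of l "- l + f i"] triangle[of "f i" "- f i + l"] norm_diff_commute'[of l "f i"]
      by (simp add: dist_real_def abs_less_iff)
  qed
qed

lemma limit_unique:
  fixes f :: "'b \<Rightarrow> 'a"
  assumes "(f \<longlongrightarrow> l) F" "(f \<longlongrightarrow> l') F" "F \<noteq> bot"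
  shows "l = l'"
proof -
  have "((\<lambda>i. - f i + f i) \<longlongrightarrow> - l + l') F"
    by (intro tendsto_intros assms)
  then have "((\<lambda>i. 0::real) \<longlongrightarrow> N (- l + l')) F"
    using tendsto_norm by fastforce
  then have "N (- l + l') = 0"
    using tendsto_unique[OF assms(3)] tendsto_const by blast
  then show ?thesis by (metis zero_iff add.right_neutral add_minus_cancel)
qed

lemma norm_metric: "compatible_metric (\<lambda>g f. N (- g + f))" "left_invariant (\<lambda>g f. N (- g + f))"
proof -
  have M: "Metric_space UNIV (\<lambda>g f. N (- g + f))"
  proof
    fix x y z :: 'a
    show "N (- x + y) = 0 \<longleftrightarrow> x = y"
      by (metis zero_iff add.right_neutral add_minus_cancel left_minus)
  qed (auto simp: norm_diff_commute' triangle_diff)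
  interpret M: Metric_space UNIV "\<lambda>g f. N (- g + f)" by (rule M)
  have "openin M.mtopology S \<longleftrightarrow> open S" for S
    by (auto simp: M.openin_mtopology open_iff M.mball_def subset_iff)
  then show "compatible_metric (\<lambda>g f. N (- g + f))"
    unfolding compatible_metric_def using M
    by (simp add: topology_eq)
  show "left_invariant (\<lambda>g f. N (- g + f))"
    unfolding left_invariant_def by (simp add: group_expand del: add_uminus_conv_diff)
qed

end

lemma compatible_metric_imp_group_norm:
  fixes d :: "'a::topological_group_add \<Rightarrow> 'a \<Rightarrow> real"
  assumes "compatible_metric d" "left_invariant d"
  shows "group_norm (d 0)" and "d g f = d 0 (- g + f)"
proof -
  have d: "d g f = d 0 (- g + f)" for g f
    using assms(2) unfolding left_invariant_def by (metis left_minus)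
  then show "d g f = d 0 (- g + f)" .
  interpret M: Metric_space UNIV d using assms(1) by (simp add: compatible_metric_def)
  show "group_norm (d 0)"
  proof
    fix x y :: 'a and S :: "'a set"
    show "d 0 x = 0 \<longleftrightarrow> x = 0" by auto
    show "d 0 (- x) = d 0 x" using d[of x 0] M.commute[of x 0] by simp
    show "d 0 (x + y) \<le> d 0 x + d 0 y"
      using M.triangle[of 0 x "x + y"] d[of x "x + y"] by simp
    have "open S \<longleftrightarrow> openin M.mtopology S"
      using assms(1) by (simp add: compatible_metric_def)
    then show "open S \<longleftrightarrow> (\<forall>x\<in>S. \<exists>r>0. \<forall>y. d 0 (- x + y) < r \<longrightarrow> y \<in> S)"
      by (auto simp: M.openin_mtopology M.mball_def subset_iff d[symmetric])
  qed
qed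


section \<open>Norms from chains of neighbourhoods\<close>

text \<open>
  Frink's chain inequality. Weighting the interior summands by 4 and the two outer ones by 2 is
  what makes the induction close: both halves of the split share the summand number \<open>p\<close>.
\<close>

lemma quasi_norm_sum_list_aux:
  fixes q :: "'a::monoid_add \<Rightarrow> real"
  assumes nonneg: "\<And>x. 0 \<le> q x"
    and quasi: "\<And>x y. q (x + y) \<le> 2 * max (q x) (q y)"
    and "2 \<le> length xs"
  shows "q (sum_list xs) \<le> 4 * sum_list (map q xs) - 2 * q (hd xs) - 2 * q (last xs)"
  using assms(3)
proof (induction xs rule: length_induct)
  case (1 xs)
  define n where "n = length xs"
  have n: "2 \<le> n" using 1 by (simp add: n_def)
  have split: "q (sum_list xs) \<le> 2 * max (q (sum_list (take p xs))) (q (sum_list (drop p xs)))" for p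
    using quasi[of "sum_list (take p xs)" "sum_list (drop p xs)"]
    by (simp add: sum_list_append[symmetric])
  have outer: "q (hd xs) + q (last xs) \<le> sum_list (map q xs)"
  proof -
    obtain a ys where xs: "xs = a # ys" and ys: "ys \<noteq> []"
      using n unfolding n_def by (cases xs; cases "tl xs") auto
    have "sum_list (map q ys) = sum_list (map q (butlast ys)) + q (last ys)"
      by (subst append_butlast_last_id[OF ys, symmetric]) (simp del: append_butlast_last_id)
    moreover have "0 \<le> sum_list (map q (butlast ys))"
      by (rule sum_list_nonneg) (auto simp: nonneg)
    ultimately show ?thesis using xs ys by simp
  qed
  define P where "P p \<longleftrightarrow> q (sum_list xs) \<le> 2 * q (sum_list (take p xs))" for p
  have notP: "q (sum_list xs) \<le> 2 * q (sum_list (drop p xs))" if "\<not> P p" for p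
    using split[of p] that unfolding P_def by auto
  have ne: "xs \<noteq> []" using n by (auto simp: n_def)
  consider "P 1" | "\<not> P (n - 1)" | "\<not> P 1" "P (n - 1)" by blast
  then show ?case
  proof cases
    case 1
    have "sum_list (take 1 xs) = hd xs" using ne by (cases xs) auto
    then show ?thesis using 1 outer nonneg[of "last xs"] unfolding P_def by simp
  next
    case 2
    have "sum_list (drop (n - 1) xs) = last xs"
      using ne by (simp add: n_def last_conv_nth Cons_nth_drop_Suc[symmetric])
    then show ?thesis using notP[OF 2] outer nonneg[of "hd xs"] by simp
  next
    case 3
    obtain p where p: "1 \<le> p" "p < n - 1" "\<not> P p" "P (Suc p)"
    proof -
      have "\<exists>p\<ge>1. p < n - 1 \<and> \<not> P p \<and> P (Suc p)"
      proof (rule ccontr)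
        assume no: "\<not> ?thesis"
        have "\<not> P p" if "1 \<le> p" "p \<le> n - 1" for p
          using that(1,2)
        proof (induction p rule: dec_induct)
          case base show ?case using 3 by simp
        next
          case (step m)
          then have "m < n - 1" "\<not> P m" by auto
          then show ?case using no step.hyps by blast
        qed
        then show False using 3 n by auto
      qed
      then show ?thesis using that by blast
    qed
    have pn: "Suc p < length xs" using p by (simp add: n_def)
    let ?A = "take (Suc p) xs" and ?B = "drop p xs"
    note IH = "1.IH"[rule_format]
    have "q (sum_list ?A) \<le> 4 * sum_list (map q ?A) - 2 * q (hd ?A) - 2 * q (last ?A)"
      by (rule IH) (use pn p(1) in auto)
    moreover have "q (sum_list ?B) \<le> 4 * sum_list (map q ?B) - 2 * q (hd ?B) - 2 * q (last ?B)"
      by (rule IH) (use pn p(1) in auto)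
    moreover have "hd ?A = hd xs" by (rule hd_take) simp
    moreover have "last ?B = last xs" "hd ?B = xs ! p" "last ?A = xs ! p"
      using ne pn by (auto simp: hd_drop_conv_nth take_Suc_conv_app_nth)
    moreover have "sum_list (map q ?A) + sum_list (map q ?B) = sum_list (map q xs) + q (xs ! p)"
    proof -
      have "sum_list (map q ?A) = sum_list (map q (take p xs)) + q (xs ! p)"
        using pn by (simp add: take_Suc_conv_app_nth)
      moreover have "sum_list (map q (take p xs)) + sum_list (map q ?B) = sum_list (map q xs)"
        by (simp add: sum_list_append[symmetric] map_append[symmetric] del: map_append sum_list_append)
      ultimately show ?thesis by simp
    qed
    ultimately show ?thesis using notP[OF p(3)] p(4) unfolding P_def by simp
  qed
qed

lemma quasi_norm_sum_list:
  fixes q :: "'a::monoid_add \<Rightarrow> real"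
  assumes "\<And>x. 0 \<le> q x" "q 0 = 0" "\<And>x y. q (x + y) \<le> 2 * max (q x) (q y)"
  shows "q (sum_list xs) \<le> 4 * sum_list (map q xs)"
proof (cases "2 \<le> length xs")
  case True
  show ?thesis
    using quasi_norm_sum_list_aux[of q, OF assms(1,3) True] assms(1)[of "hd xs"] assms(1)[of "last xs"]
    by linarith
next
  case False
  then have "xs = [] \<or> (\<exists>x. xs = [x])" by (cases xs; cases "tl xs") auto
  then show ?thesis using assms(1,2) by auto
qed

lemma sum_list_rev_uminus:
  fixes xs :: "'a::group_add list"
  shows "sum_list (rev (map uminus xs)) = - sum_list xs"
  by (induction xs) (simp_all add: minus_add del: add_uminus_conv_diff)

text \<open>
  A Birkhoff--Kakutani theorem in which consecutive neighbourhoods are only required to satisfy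
  \<open>U\<^sub>k\<^sub>+\<^sub>1 + U\<^sub>k\<^sub>+\<^sub>1 \<subseteq> U\<^sub>k\<close>. That two summands suffice matters below: the multiples \<open>j g\<close>
  with \<open>\<bar>j\<bar> \<le> 2 ^ l\<close> form a chain of this kind, with a loss of exactly one half at every step.
\<close>

lemma (in group_norm) birkhoff_kakutani:
  fixes U :: "nat \<Rightarrow> 'a set"
  assumes U0: "U 0 = UNIV"
    and opn: "\<And>k. open (U k)"
    and zero_in: "\<And>k. 0 \<in> U k"
    and sym: "\<And>k x. x \<in> U k \<Longrightarrow> - x \<in> U k"
    and add: "\<And>k x y. x \<in> U (Suc k) \<Longrightarrow> y \<in> U (Suc k) \<Longrightarrow> x + y \<in> U k"
    and small: "\<And>r. 0 < r \<Longrightarrow> \<exists>k. \<forall>x\<in>U k. N x < r"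
  shows "\<exists>M. group_norm M \<and> (\<forall>k. \<forall>x\<in>U k. M x \<le> (1/2) ^ k)"
proof -
  have decr: "U (Suc k) \<subseteq> U k" for k using add[of _ k 0] zero_in by force
  have mono: "U k \<subseteq> U j" if "j \<le> k" for j k
    by (rule lift_Suc_antimono_le[of U]) (use decr that in auto)
  \<comment> \<open>The level function of the chain is a quasi-norm; the infimum of its sums over all
    decompositions of \<open>x\<close> is a norm, comparable to it by the chain inequality.\<close>
  define q where "q x = Inf {(1/2::real) ^ k | k. x \<in> U k}" for x
  have bdd: "bdd_below {(1/2::real) ^ k | k. x \<in> U k}" for x
    by (rule bdd_belowI[of _ 0]) auto
  have ne: "{(1/2::real) ^ k | k. x \<in> U k} \<noteq> {}" for x using U0 by blast
  have q_le: "q x \<le> (1/2) ^ k" if "x \<in> U k" for x k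
    unfolding q_def by (rule cInf_lower[OF _ bdd]) (use that in auto)
  have q_less: "\<exists>k. x \<in> U k \<and> (1/2) ^ k < a" if "q x < a" for x a
    using that unfolding q_def cInf_less_iff[OF ne bdd] by auto
  have q_nonneg: "0 \<le> q x" for x
    unfolding q_def by (rule cInf_greatest[OF ne]) auto
  have q_in: "x \<in> U k" if qx: "q x < (1/2) ^ k" for x k
  proof -
    obtain j where "x \<in> U j" "(1/2::real) ^ j < (1/2) ^ k" using q_less[OF qx] by blast
    moreover from this have "k \<le> j" using power_strict_decreasing_iff[of "1/2::real" j k] by auto
    ultimately show ?thesis using mono by blast
  qed
  have q0: "q 0 = 0"
  proof (rule ccontr)
    assume "q 0 \<noteq> 0"
    then have "0 < q 0" using q_nonneg[of 0] by linarith
    then obtain k where "(1/2::real) ^ k < q 0" using real_arch_pow_inv[of "q 0" "1/2"] by auto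
    then show False using q_le[OF zero_in[of k]] by linarith
  qed
  have q_sym: "q (- x) = q x" for x
  proof -
    have "- x \<in> U k \<longleftrightarrow> x \<in> U k" for k using sym[of x k] sym[of "- x" k] by auto
    then show ?thesis by (simp add: q_def)
  qed
  have q_quasi: "q (x + y) \<le> 2 * max (q x) (q y)" for x y
  proof (rule ccontr)
    assume "\<not> ?thesis"
    then have *: "q x < q (x + y) / 2" "q y < q (x + y) / 2" by auto
    obtain i where i: "x \<in> U i" "(1/2) ^ i < q (x + y) / 2" using q_less[OF *(1)] by blast
    obtain j where j: "y \<in> U j" "(1/2) ^ j < q (x + y) / 2" using q_less[OF *(2)] by blast
    define m where "m = min i j"
    have m: "x \<in> U m" "y \<in> U m" "(1/2) ^ m < q (x + y) / 2"
      using i j mono[of m i] mono[of m j] by (auto simp: m_def min_def)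
    show False
    proof (cases m)
      case 0
      then show ?thesis using m q_le[of "x + y" 0] U0 by simp
    next
      case (Suc n)
      then show ?thesis using m q_le[OF add, of x n y] by simp
    qed
  qed
  define W where "W x = {sum_list (map q xs) | xs. sum_list xs = x}" for x
  have W_nonneg: "0 \<le> a" if "a \<in> W x" for a x
    using that unfolding W_def by (auto intro!: sum_list_nonneg q_nonneg)
  have W_bdd: "bdd_below (W x)" for x using W_nonneg by (meson bdd_belowI)
  have W_q: "q x \<in> W x" for x unfolding W_def by (rule CollectI, rule exI[of _ "[x]"]) simp
  define M where "M x = Inf (W x)" for x
  have M_le_q: "M x \<le> q x" for x
    unfolding M_def by (rule cInf_lower[OF W_q W_bdd])
  have M_nonneg: "0 \<le> M x" for x
    unfolding M_def by (rule cInf_greatest) (use W_q W_nonneg in blast)+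
  have q_le_M: "q x \<le> 4 * M x" for x
  proof -
    have "q x / 4 \<le> M x" unfolding M_def
    proof (rule cInf_greatest)
      show "W x \<noteq> {}" using W_q by blast
      fix a assume "a \<in> W x"
      then obtain xs where "a = sum_list (map q xs)" "sum_list xs = x" unfolding W_def by auto
      moreover have "q (sum_list xs) \<le> 4 * sum_list (map q xs)"
        by (rule quasi_norm_sum_list) (fact q_nonneg q0 q_quasi)+
      ultimately show "q x / 4 \<le> a" by simp
    qed
    then show ?thesis by simp
  qed
  have M_add: "M (x + y) \<le> M x + M y" for x y
  proof (rule field_le_epsilon)
    fix e :: real assume e: "e > 0"
    have "\<exists>a\<in>W x. a < M x + e/2" "\<exists>b\<in>W y. b < M y + e/2"
      using e cInf_less_iff[OF _ W_bdd] W_q unfolding M_def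
      by (metis empty_iff less_add_same_cancel1 half_gt_zero)+
    then obtain xs ys where "sum_list (map q xs) < M x + e/2" "sum_list xs = x"
      "sum_list (map q ys) < M y + e/2" "sum_list ys = y" unfolding W_def by auto
    moreover from this have "M (x + y) \<le> sum_list (map q (xs @ ys))"
      unfolding M_def by (intro cInf_lower[OF _ W_bdd]) (auto simp: W_def intro!: exI[of _ "xs @ ys"])
    ultimately show "M (x + y) \<le> M x + M y + e" by simp
  qed
  have W_sym: "W x \<subseteq> W (- x)" for x
  proof
    fix a assume "a \<in> W x"
    then obtain xs where xs: "a = sum_list (map q xs)" "sum_list xs = x" unfolding W_def by auto
    have "sum_list (map q (rev (map uminus xs))) = a"
      using xs by (simp add: rev_map[symmetric] sum_list_rev q_sym comp_def)
    then show "a \<in> W (- x)" using xs sum_list_rev_uminus[of xs] unfolding W_def by blast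
  qed
  have M_sym: "M (- x) = M x" for x
    using W_sym[of x] W_sym[of "- x"] by (simp add: M_def subset_antisym)
  have M_zero: "M x = 0 \<longleftrightarrow> x = 0" for x
  proof
    assume "M x = 0"
    then have "x \<in> U k" for k using q_le_M[of x] q_in[of x k] by (simp add: le_less_trans)
    then have "\<not> 0 < N x" using small[of "N x"] by blast
    then show "x = 0" using nonneg[of x] zero_iff[of x] by linarith
  qed (use M_le_q[of 0] M_nonneg[of 0] q0 in simp)
  have M_open: "open S \<longleftrightarrow> (\<forall>x\<in>S. \<exists>r>0. \<forall>y. M (- x + y) < r \<longrightarrow> y \<in> S)" for S
  proof
    assume S: "open S"
    show "\<forall>x\<in>S. \<exists>r>0. \<forall>y. M (- x + y) < r \<longrightarrow> y \<in> S"
    proof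
      fix x assume "x \<in> S"
      then obtain r where r: "r > 0" "\<And>y. N (- x + y) < r \<Longrightarrow> y \<in> S"
        using open_contains_ball[OF S] by blast
      obtain k where k: "\<forall>x\<in>U k. N x < r" using small[OF r(1)] by blast
      have "y \<in> S" if "M (- x + y) < (1/2) ^ k / 4" for y
        using that q_le_M[of "- x + y"] by (intro r(2) k[rule_format] q_in) linarith
      then show "\<exists>r>0. \<forall>y. M (- x + y) < r \<longrightarrow> y \<in> S"
        by (intro exI[of _ "(1/2) ^ k / 4"]) auto
    qed
  next
    assume R: "\<forall>x\<in>S. \<exists>r>0. \<forall>y. M (- x + y) < r \<longrightarrow> y \<in> S"
    show "open S" unfolding open_iff
    proof
      fix x assume "x \<in> S"
      then obtain r where r: "r > 0" "\<And>y. M (- x + y) < r \<Longrightarrow> y \<in> S" using R by blast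
      obtain k where k: "(1/2::real) ^ k < r" using real_arch_pow_inv[OF r(1), of "1/2"] by auto
      obtain s where s: "s > 0" "\<And>y. N (- 0 + y) < s \<Longrightarrow> y \<in> U k"
        using open_contains_ball[OF opn zero_in] by blast
      have "y \<in> S" if "N (- x + y) < s" for y
        using s(2)[of "- x + y"] that q_le[of "- x + y" k] M_le_q[of "- x + y"] k
        by (intro r(2)) auto
      then show "\<exists>r>0. \<forall>y. N (- x + y) < r \<longrightarrow> y \<in> S" using s(1) by blast
    qed
  qed
  have "group_norm M"
    by unfold_locales (fact M_zero M_sym M_add M_open)+
  moreover have "M x \<le> (1/2) ^ k" if "x \<in> U k" for x k
    using M_le_q[of x] q_le[OF that] by linarith
  ultimately show ?thesis by blast
qed


section \<open>Minimal metrics\<close>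

text \<open>
  The refinement step for a chain of symmetric neighbourhoods, prescribing finitely many elements
  that the next neighbourhood has to contain.
\<close>

lemma (in group_norm) nbhd_of_finite_set:
  fixes U A :: "'a set"
  assumes U: "open U" and A: "finite A" and add: "\<And>a b. a \<in> A \<Longrightarrow> b \<in> A \<Longrightarrow> a + b \<in> U"
    and sym: "\<And>a. a \<in> A \<Longrightarrow> - a \<in> A"
  obtains V where "open V" "A \<subseteq> V" "\<And>x. x \<in> V \<Longrightarrow> - x \<in> V"
    "\<And>x y. x \<in> V \<Longrightarrow> y \<in> V \<Longrightarrow> x + y \<in> U"
proof -
  have "\<exists>r>0. \<forall>x y. N (- fst p + x) < r \<longrightarrow> N (- snd p + y) < r \<longrightarrow> x + y \<in> U"
    if p: "p \<in> A \<times> A" for p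
  proof -
    obtain a b where ab: "p = (a, b)" by (cases p)
    have "\<forall>\<^sub>F z in nhds a \<times>\<^sub>F nhds b. fst z + snd z \<in> U"
      using p ab add by (intro topological_tendstoD[OF tendsto_add_Pair U]) auto
    then obtain P Q where PQ: "\<forall>\<^sub>F x in nhds a. P x" "\<forall>\<^sub>F y in nhds b. Q y"
      "\<And>x y. P x \<Longrightarrow> Q y \<Longrightarrow> x + y \<in> U"
      unfolding eventually_prod_filter by auto
    obtain S where S: "open S" "a \<in> S" "\<And>x. x \<in> S \<Longrightarrow> P x"
      using PQ(1) unfolding eventually_nhds by blast
    obtain T where T: "open T" "b \<in> T" "\<And>x. x \<in> T \<Longrightarrow> Q x"
      using PQ(2) unfolding eventually_nhds by blast
    obtain r where r: "r > 0" "\<And>x. N (- a + x) < r \<Longrightarrow> x \<in> S"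
      using open_contains_ball[OF S(1,2)] by blast
    obtain s where s: "s > 0" "\<And>x. N (- b + x) < s \<Longrightarrow> x \<in> T"
      using open_contains_ball[OF T(1,2)] by blast
    show ?thesis
      using r s S T PQ(3) by (intro exI[of _ "min r s"]) (auto simp: ab)
  qed
  then obtain f where f: "\<And>p. p \<in> A \<times> A \<Longrightarrow> 0 < f p"
    "\<And>p x y. p \<in> A \<times> A \<Longrightarrow> N (- fst p + x) < f p \<Longrightarrow> N (- snd p + y) < f p \<Longrightarrow> x + y \<in> U"
    by metis
  define r where "r = Min (insert 1 (f ` (A \<times> A)))"
  have r: "r > 0" "\<And>p. p \<in> A \<times> A \<Longrightarrow> r \<le> f p" using A f(1) by (auto simp: r_def)
  define B where "B = (\<Union>a\<in>A. {x. N (- a + x) < r})"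
  define V where "V = B \<inter> uminus -` B"
  have B: "open B" unfolding B_def by (intro open_UN ballI open_ball)
  have "open (uminus -` B)"
    by (rule open_vimage[OF B]) (auto simp: continuous_on_def intro!: tendsto_intros)
  then have "open V" using B by (simp add: V_def open_Int)
  moreover have "A \<subseteq> B" using r(1) by (auto simp: B_def intro!: bexI)
  then have "A \<subseteq> V" using sym by (auto simp: V_def)
  moreover have "- x \<in> V" if "x \<in> V" for x using that by (auto simp: V_def)
  moreover have "x + y \<in> U" if xy: "x \<in> V" "y \<in> V" for x y
  proof -
    obtain a b where "a \<in> A" "b \<in> A" "N (- a + x) < r" "N (- b + y) < r"
      using xy by (auto simp: V_def B_def)
    then show ?thesis using f(2)[of "(a, b)" x y] r(2)[of "(a, b)"] by auto
  qed
  ultimately show ?thesis by (rule that)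
qed

text \<open>
  If there are arbitrarily small cyclic segments \<open>0, g, \<dots>, n g\<close> with \<open>n N(g)\<close> arbitrarily large,
  infinitely many of them can be built into one chain of neighbourhoods. The norm of that chain
  is of order at most \<open>1 / n\<close> at such \<open>g\<close>, so that \<open>N\<close> is not bounded by a multiple of it. In the
  construction a state \<open>(U, g, l, c)\<close> at step \<open>n\<close> says that the segment of length \<open>2 ^ l\<close> generated
  by \<open>g\<close> still has to be halved \<open>l\<close> times; \<open>c\<close> is the step at which \<open>g\<close> was introduced.
\<close>

lemma (in group_norm) exists_incomparable_norm:
  assumes no: "\<And>r K. 0 < r \<Longrightarrow> \<exists>g n. (\<forall>j\<le>n. N (nmult j g) < r) \<and> K < real n * N g"
  obtains M where "group_norm M"
    "\<And>n. \<exists>g. g \<noteq> 0 \<and> N g < 1 / Suc n \<and> real (Suc n) * M g \<le> N g"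
proof -
  define P :: "nat \<Rightarrow> 'a set \<times> 'a \<times> nat \<times> nat \<Rightarrow> bool" where
    "P n = (\<lambda>(U, g, l, c). open U \<and> (\<forall>x\<in>U. - x \<in> U) \<and> (\<forall>j\<le>2 ^ l. nmult j g \<in> U) \<and>
        real c * (1/2) ^ (n + l) \<le> N g \<and> (n = 0 \<longrightarrow> U = UNIV))" for n
  define Q :: "nat \<Rightarrow> 'a set \<times> 'a \<times> nat \<times> nat \<Rightarrow> 'a set \<times> 'a \<times> nat \<times> nat \<Rightarrow> bool" where
    "Q n = (\<lambda>(U, g, l, c) (U', g', l', c'). (\<forall>x\<in>U'. \<forall>y\<in>U'. x + y \<in> U) \<and>
        (0 < l \<longrightarrow> Suc l' = l \<and> g' = g \<and> c' = c) \<and>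
        (l = 0 \<longrightarrow> c' = Suc n \<and> (\<forall>x\<in>U'. N x < 1 / Suc n)))" for n
  have "\<exists>f. \<forall>n. P n (f n) \<and> Q n (f n) (f (Suc n))"
  proof (rule dependent_nat_choice)
    show "\<exists>s. P 0 s"
      by (rule exI[of _ "(UNIV, 0, 0, 0)"]) (simp add: P_def)
  next
    fix s n assume Ps: "P n s"
    obtain U g l c where s: "s = (U, g, l, c)" by (cases s)
    have U: "open U" "\<And>x. x \<in> U \<Longrightarrow> - x \<in> U" "\<And>j. j \<le> 2 ^ l \<Longrightarrow> nmult j g \<in> U"
      and c: "real c * (1/2) ^ (n + l) \<le> N g"
      using Ps by (auto simp: P_def s)
    show "\<exists>t. P (Suc n) t \<and> Q n s t"
    proof (cases l)
      case 0
      have "0 \<in> U" using U(3)[of 0] by simp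
      then have "finite {0::'a}" "\<And>a b. a \<in> {0} \<Longrightarrow> b \<in> {0} \<Longrightarrow> a + b \<in> U"
        "\<And>a. a \<in> {0} \<Longrightarrow> - a \<in> {0::'a}" by auto
      then obtain V where V: "open V" "{0} \<subseteq> V" "\<And>x y. x \<in> V \<Longrightarrow> y \<in> V \<Longrightarrow> x + y \<in> U"
        using nbhd_of_finite_set[OF U(1), of "{0}"] by metis
      obtain r where r: "r > 0" "\<And>y. N y < r \<Longrightarrow> y \<in> V"
        using open_contains_ball[OF V(1), of 0] V(2) by auto
      define r' where "r' = min r (1 / Suc n)"
      have r': "r' > 0" using r by (simp add: r'_def)
      obtain h m where hm: "\<And>j. j \<le> m \<Longrightarrow> N (nmult j h) < r'" "real (Suc n) < real m * N h"
        using no[OF r', of "real (Suc n)"] by blast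
      have "m \<noteq> 0"
      proof
        assume "m = 0"
        then show False using hm(2) by simp
      qed
      \<comment> \<open>The segment is cut down to a length that can be halved \<open>l'\<close> times.\<close>
      then obtain l' where l': "2 ^ l' \<le> m" "m < 2 ^ (l' + 1)"
        using ex_power_ivl1[of 2 m] by auto
      define W where "W = {x. N x < r'}"
      have "real m * N h \<le> 2 ^ (l' + 1) * N h"
        using l'(2) by (intro mult_right_mono) (auto simp flip: of_nat_less_iff[where 'a=real])
      then have "real (Suc n) \<le> 2 ^ (l' + 1) * N h" using hm(2) by linarith
      then have "real (Suc n) * (1/2) ^ (l' + 1) \<le> N h"
        by (simp add: field_simps)
      moreover have "(1/2::real) ^ (Suc n + l') \<le> (1/2) ^ (l' + 1)"
        by (rule power_decreasing) auto
      ultimately have "real (Suc n) * (1/2) ^ (Suc n + l') \<le> N h"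
        by (meson mult_left_mono of_nat_0_le_iff order_trans)
      then have "P (Suc n) (W, h, l', Suc n)"
        using hm(1) l'(1) open_ball0[of r'] by (auto simp: P_def W_def norm_uminus)
      moreover have "Q n s (W, h, l', Suc n)"
        using V(3) r(2) by (auto simp: Q_def s 0 W_def r'_def)
      ultimately show ?thesis by blast
    next
      case (Suc l')
      define A where "A = (\<lambda>j. imult j g) ` {- (2 ^ l')..2 ^ l'}"
      have inU: "imult j g \<in> U" if "\<bar>j\<bar> \<le> 2 ^ l" for j
      proof -
        have "nmult (nat \<bar>j\<bar>) g \<in> U" by (rule U(3)) (use that in \<open>simp add: nat_le_iff\<close>)
        then show ?thesis using U(2) by (auto simp: imult_def abs_if split: if_splits)
      qed
      have "a + b \<in> U" if "a \<in> A" "b \<in> A" for a b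
        using that unfolding A_def by (auto simp: imult_add[symmetric] Suc intro!: inU)
      moreover have "- a \<in> A" if "a \<in> A" for a
        using that unfolding A_def by (force simp: imult_uminus[symmetric])
      moreover have "finite A" by (simp add: A_def)
      ultimately obtain V where V: "open V" "A \<subseteq> V" "\<And>x. x \<in> V \<Longrightarrow> - x \<in> V"
        "\<And>x y. x \<in> V \<Longrightarrow> y \<in> V \<Longrightarrow> x + y \<in> U"
        using nbhd_of_finite_set[OF U(1), of A] by metis
      have "nmult j g \<in> V" if "j \<le> 2 ^ l'" for j
      proof -
        have "int j \<le> int (2 ^ l')" using that by (simp only: of_nat_le_iff)
        moreover have "- (2 ^ l') \<le> (0::int)" by simp
        then have "- (2 ^ l') \<le> int j" using of_nat_0_le_iff order_trans by blast
        ultimately have "imult (int j) g \<in> A" unfolding A_def by (intro imageI) simp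
        then show ?thesis using V(2) by auto
      qed
      then have "P (Suc n) (V, g, l', c)" using V c by (auto simp: P_def Suc)
      moreover have "Q n s (V, g, l', c)" using V(4) by (auto simp: Q_def s Suc)
      ultimately show ?thesis by blast
    qed
  qed
  then obtain f where f: "\<And>n. P n (f n)" "\<And>n. Q n (f n) (f (Suc n))" by blast
  define U where "U n = fst (f n)" for n
  define g where "g n = fst (snd (f n))" for n
  define l where "l n = fst (snd (snd (f n)))" for n
  define c where "c n = snd (snd (snd (f n)))" for n
  have f_eq: "f n = (U n, g n, l n, c n)" for n by (simp add: U_def g_def l_def c_def)
  have U: "open (U n)" "x \<in> U n \<Longrightarrow> - x \<in> U n" "j \<le> 2 ^ l n \<Longrightarrow> nmult j (g n) \<in> U n"
    "real (c n) * (1/2) ^ (n + l n) \<le> N (g n)" "U 0 = UNIV" for n x j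
    using f(1)[of n] f(1)[of 0] by (auto simp: f_eq P_def)
  have step: "x \<in> U (Suc n) \<Longrightarrow> y \<in> U (Suc n) \<Longrightarrow> x + y \<in> U n"
    "0 < l n \<Longrightarrow> Suc (l (Suc n)) = l n \<and> c (Suc n) = c n"
    "l n = 0 \<Longrightarrow> c (Suc n) = Suc n"
    "l n = 0 \<Longrightarrow> x \<in> U (Suc n) \<Longrightarrow> N x < 1 / Suc n" for n x y
    using f(2)[of n] by (auto simp: f_eq Q_def)
  have zero_in: "0 \<in> U n" for n using U(3)[of 0 n] by simp
  have decr: "U k \<subseteq> U j" if "j \<le> k" for j k
    by (rule lift_Suc_antimono_le[of U]) (use step(1) zero_in that in \<open>force+\<close>)
  have finish: "l (n + l n) = 0 \<and> c (n + l n) = c n" for n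
  proof (induction "l n" arbitrary: n)
    case (Suc m)
    then have "l (Suc n) = m" "c (Suc n) = c n" using step(2)[of n] by auto
    then show ?case using Suc(1)[of "Suc n"] Suc(2)[symmetric] by simp
  qed simp
  have restart: "\<exists>m\<ge>n. l m = 0" for n using finish[of n] by (intro exI[of _ "n + l n"]) auto
  have small: "\<exists>k. \<forall>x\<in>U k. N x < r" if r: "0 < r" for r
  proof -
    obtain n where n: "1 / Suc n < r" using nat_approx_posE[OF r] by blast
    obtain m where m: "m \<ge> n" "l m = 0" using restart by blast
    have "1 / Suc m \<le> 1 / Suc n" using m(1) by (simp add: field_simps)
    then have "\<forall>x\<in>U (Suc m). N x < r" using step(4)[OF m(2)] n by fastforce
    then show ?thesis by blast
  qed
  obtain M where M: "group_norm M" "\<And>k x. x \<in> U k \<Longrightarrow> M x \<le> (1/2) ^ k"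
    using birkhoff_kakutani[of U] U(1,2,5) zero_in step(1) small by metis
  have "\<exists>g. g \<noteq> 0 \<and> N g < 1 / Suc n \<and> real (Suc n) * M g \<le> N g" for n
  proof -
    obtain m where m: "m \<ge> n" "l m = 0" using restart by blast
    define k where "k = Suc m + l (Suc m)"
    have k: "l k = 0" "c k = Suc m" using finish[of "Suc m"] step(3)[OF m(2)] by (auto simp: k_def)
    have gk: "g k \<in> U k" using U(3)[of 1 k] by simp
    then have "g k \<in> U (Suc m)" using decr[of "Suc m" k] by (auto simp: k_def)
    then have "N (g k) < 1 / Suc m" using step(4)[OF m(2)] by blast
    moreover have "1 / Suc m \<le> 1 / Suc n" using m(1) by (simp add: field_simps)
    moreover have N: "real (Suc m) * (1/2) ^ k \<le> N (g k)" using U(4)[of k] k by simp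
    moreover have "real (Suc n) * M (g k) \<le> real (Suc m) * (1/2) ^ k"
      using m(1) M(2)[OF gk] group_norm.nonneg[OF M(1)] by (intro mult_mono) auto
    moreover have "0 < real (Suc m) * (1/2) ^ k" by simp
    then have "g k \<noteq> 0" using N zero_iff[of "g k"] by linarith
    ultimately show ?thesis by (intro exI[of _ "g k"]) linarith
  qed
  then show ?thesis using that M(1) by blast
qed

text \<open>
  Elements whose first \<open>n\<close> multiples stay in a fixed small ball have norm of order at most
  \<open>1 / n\<close>.
\<close>

locale gleason_norm = group_norm +
  fixes r K :: real
  assumes r_pos: "0 < r" and K_pos: "0 < K"
    and escape: "(\<And>j. j \<le> n \<Longrightarrow> N (nmult j g) < r) \<Longrightarrow> real n * N g \<le> K"

lemma minimal_metric_imp_gleason_norm: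
  fixes d :: "'a::topological_group_add \<Rightarrow> 'a \<Rightarrow> real"
  assumes "minimal_metric d"
  obtains r K where "gleason_norm (d 0) r K"
proof -
  have d: "compatible_metric d" "left_invariant d"
    and min: "\<And>e. compatible_metric e \<Longrightarrow> left_invariant e \<Longrightarrow>
      \<exists>U K. 0 \<in> interior U \<and> (\<forall>g\<in>U. \<forall>f\<in>U. d g f \<le> K * e g f)"
    using assms unfolding minimal_metric_def by blast+
  interpret group_norm "d 0" using d by (rule compatible_metric_imp_group_norm(1))
  have "\<exists>r>0. \<exists>K. \<forall>g n. (\<forall>j\<le>n. d 0 (nmult j g) < r) \<longrightarrow> real n * d 0 g \<le> K"
  proof (rule ccontr)
    assume "\<not> ?thesis"
    then have "\<exists>g n. (\<forall>j\<le>n. d 0 (nmult j g) < r) \<and> K < real n * d 0 g" if "0 < r" for r K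
      using that by (meson not_less)
    then obtain M where M: "group_norm M"
      "\<And>n. \<exists>g. g \<noteq> 0 \<and> d 0 g < 1 / Suc n \<and> real (Suc n) * M g \<le> d 0 g"
      using exists_incomparable_norm by metis
    interpret M: group_norm M by (rule M)
    obtain U K where U: "0 \<in> interior U" "\<And>g. g \<in> U \<Longrightarrow> d 0 g \<le> K * M g"
    proof -
      obtain U K where *: "0 \<in> interior U" "\<forall>g\<in>U. \<forall>f\<in>U. d g f \<le> K * M (- g + f)"
        using min[OF M.norm_metric] by blast
      moreover have "0 \<in> U" using * interior_subset by blast
      ultimately show ?thesis using that by force
    qed
    obtain s where s: "s > 0" "\<And>y. d 0 y < s \<Longrightarrow> y \<in> U"
      using open_contains_ball[OF open_interior U(1)] interior_subset[of U]
      by (metis add_0 minus_zero subsetD)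
    obtain n1 n2 where n: "1 / Suc n1 < s" "K < real n2"
      using nat_approx_posE[OF s(1)] reals_Archimedean2[of K] by metis
    define n where "n = max n1 n2"
    obtain g where g: "g \<noteq> 0" "d 0 g < 1 / Suc n" "real (Suc n) * M g \<le> d 0 g"
      using M(2) by blast
    have "1 / Suc n \<le> 1 / Suc n1" by (simp add: n_def field_simps)
    then have "d 0 g \<le> K * M g" using g(2) n(1) by (intro U(2) s(2)) linarith
    moreover have "0 < M g" using M.nonneg[of g] M.zero_iff[of g] g(1) by linarith
    then have "K * M g < real (Suc n) * M g" using n(2)
      by (intro mult_strict_right_mono) (auto simp: n_def)
    ultimately show False using g(3) by linarith
  qed
  then obtain r K where rK: "r > 0" "\<And>g n. (\<forall>j\<le>n. d 0 (nmult j g) < r) \<Longrightarrow> real n * d 0 g \<le> K"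
    by blast
  have "gleason_norm (d 0) r (max K 1)"
  proof
    fix n g assume "\<And>j. j \<le> n \<Longrightarrow> d 0 (nmult j g) < r"
    then show "real n * d 0 g \<le> max K 1" using rK(2)[of n g] by auto
  qed (use rK in auto)
  then show ?thesis using that by blast
qed


section \<open>Consequences of the escape property\<close>

context gleason_norm
begin

text \<open>
  The constant by which \<open>n N(g)\<close> is controlled by \<open>N (n g)\<close>, provided that the multiples of
  \<open>g\<close> up to \<open>n g\<close> stay small.
\<close>

definition growth :: real where "growth = 4 * K / r"

lemma growth_pos: "0 < growth"
  using r_pos K_pos by (simp add: growth_def)

text \<open>
  With \<open>t = N (n g)\<close>, the multiples of \<open>g\<close> stay in the ball of radius \<open>r\<close> not only up to \<open>n\<close>
  but up to \<open>m n\<close> with \<open>m\<close> of order \<open>r / t\<close>; the escape property applies to this longer segment.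
\<close>

lemma linear_growth:
  assumes small: "\<And>j. j \<le> n \<Longrightarrow> N (nmult j g) < r / 2"
  shows "real n * N g \<le> growth * N (nmult n g)"
proof (cases "n = 0")
  case False
  define t where "t = N (nmult n g)"
  have t: "0 \<le> t" "t < r / 2" using small[of n] by (auto simp: t_def)
  have bound: "real m * (real n * N g) \<le> K" if m: "real m * t \<le> r / 2" for m
  proof -
    have "real (m * n) * N g \<le> K"
    proof (rule escape)
      fix j assume j: "j \<le> m * n"
      define a b where "a = j div n" and "b = j mod n"
      have jab: "j = a * n + b" by (simp add: a_def b_def)
      have b: "b \<le> n" using False by (simp add: b_def less_imp_le)
      have a: "a \<le> m" using j div_le_mono[of j "m * n" n] False by (simp add: a_def)
      have "N (nmult j g) \<le> N (nmult a (nmult n g)) + N (nmult b g)"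
        using triangle[of "nmult (a * n) g" "nmult b g"] by (simp add: jab nmult_add nmult_nmult)
      also have "N (nmult a (nmult n g)) \<le> real a * t" unfolding t_def by (rule nmult_le)
      also have "real a * t \<le> real m * t" using a t by (intro mult_right_mono) auto
      finally show "N (nmult j g) < r" using m small[OF b] by linarith
    qed
    then show ?thesis by (simp add: mult.assoc)
  qed
  show ?thesis
  proof (cases "t = 0")
    case True
    have "real n * N g \<le> 0"
    proof (rule ccontr)
      assume "\<not> ?thesis"
      then obtain m where "K < real m * (real n * N g)"
        using reals_Archimedean3[of "real n * N g"] by (auto simp: not_le)
      then show False using bound[of m] True r_pos by auto
    qed
    then show ?thesis using True by (simp add: t_def)
  next
    case t0: False
    then have t_pos: "0 < t" using t by simp
    define m where "m = nat \<lfloor>r / (2 * t)\<rfloor>"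
    have q: "1 < r / (2 * t)" using t t_pos by (simp add: field_simps)
    then have m1: "1 \<le> m" and m_le: "real m \<le> r / (2 * t)" and m_gt: "r / (2 * t) < real m + 1"
      unfolding m_def by linarith+
    have "real m * t \<le> r / 2" using m_le t_pos by (simp add: field_simps)
    then have mK: "real m * (real n * N g) \<le> K" by (rule bound)
    have "r / (2 * t) \<le> 2 * real m" using m1 m_gt by simp
    then have "r / (4 * t) \<le> real m" using t_pos by (simp add: field_simps)
    then have "r / (4 * t) * (real n * N g) \<le> real m * (real n * N g)"
      by (rule mult_right_mono) simp
    then have "r / (4 * t) * (real n * N g) \<le> K" using mK by linarith
    then show ?thesis using t_pos r_pos unfolding growth_def t_def[symmetric]
      by (simp add: field_simps)
  qed
qed simp

text \<open>
  Conjugation by small elements is locally Lipschitz, uniformly in the conjugating element: the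
  multiples of a conjugate are the conjugates of the multiples, and these are small as long as
  the multiples are.
\<close>

lemma conj_le:
  assumes "N f < r / 4" "N x < r / 4"
  shows "N (- f + x + f) \<le> 2 * growth * N x"
proof (cases "x = 0")
  case False
  then have x: "0 < N x" using zero_iff[of x] nonneg[of x] by linarith
  define n where "n = nat \<lfloor>r / (4 * N x)\<rfloor>"
  have "1 < r / (4 * N x)" using assms(2) x by (simp add: field_simps)
  then have n1: "1 \<le> n" and n_le: "real n \<le> r / (4 * N x)" and n_gt: "r / (4 * N x) < real n + 1"
    unfolding n_def by linarith+
  have nx: "real n * N x \<le> r / 4" using n_le x by (simp add: field_simps)
  have "real n * N (- f + x + f) \<le> K"
  proof (rule escape)
    fix j assume j: "j \<le> n"
    have "N (nmult j x) \<le> real n * N x"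
      using nmult_le[of j x] j mult_right_mono[of "real j" "real n" "N x"] by auto
    then show "N (nmult j (- f + x + f)) < r"
      using triangle3[of "- f" "nmult j x" f] nx assms(1) norm_uminus[of f] r_pos
      unfolding nmult_conj by linarith
  qed
  moreover have "r / (4 * N x) \<le> 2 * real n" using n1 n_gt by simp
  then have "r / (8 * N x) \<le> real n" using x by (simp add: field_simps)
  then have "r / (8 * N x) * N (- f + x + f) \<le> real n * N (- f + x + f)"
    by (rule mult_right_mono) simp
  ultimately have "r / (8 * N x) * N (- f + x + f) \<le> K" by linarith
  then show ?thesis using x r_pos unfolding growth_def by (simp add: field_simps)
qed simp

lemma exists_escape_time:
  assumes "u \<noteq> 0" "N u < s / 2" "s \<le> r"
  obtains m where "\<And>j. j \<le> m \<Longrightarrow> N (nmult j u) < s" "s / 2 \<le> N (nmult m u)"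
proof -
  have u: "0 < N u" using assms(1) zero_iff[of u] nonneg[of u] by linarith
  have "\<exists>j. s / 2 \<le> N (nmult j u)"
  proof (rule ccontr)
    assume no: "\<not> ?thesis"
    have "N (nmult j u) < r" for j
      using no u assms(2,3) nonneg[of "nmult j u"] by (smt (verit) field_sum_of_halves)
    then have "real n * N u \<le> K" for n by (intro escape)
    then show False using reals_Archimedean3[OF u, rule_format, of K] by (meson not_less)
  qed
  define m where "m = (LEAST j. s / 2 \<le> N (nmult j u))"
  have m: "s / 2 \<le> N (nmult m u)" unfolding m_def by (rule LeastI_ex) fact
  have below: "N (nmult j u) < s / 2" if "j < m" for j
    using not_less_Least[of j "\<lambda>j. s / 2 \<le> N (nmult j u)"] that by (auto simp: m_def)
  have "N (nmult j u) < s" if "j \<le> m" for j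
  proof (cases "j < m")
    case True
    then show ?thesis using below[of j] u assms(2) by linarith
  next
    case False
    then have j: "j = m" using that by simp
    show ?thesis
    proof (cases m)
      case 0
      then show ?thesis using j u assms(2) by simp
    next
      case (Suc i)
      then show ?thesis using j triangle[of "nmult i u" u] below[of i] assms(2) by simp
    qed
  qed
  then show ?thesis using that m by blast
qed

text \<open>
  Expanding \<open>m (w - u)\<close> and moving every \<open>- u\<close> to the right produces conjugates of \<open>w\<close> by
  multiples of \<open>u\<close>.
\<close>

lemma nmult_diff_nmult_le:
  assumes "\<And>j. j \<le> m \<Longrightarrow> N (nmult j u) < r / 4" "N w < r / 4"
  shows "N (nmult m (w - u) + nmult m u) \<le> real m * (2 * growth * N w)"
  using assms(1)
proof (induction m)
  case (Suc m)
  let ?v = "nmult m u"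
  have "nmult (Suc m) (w - u) + nmult (Suc m) u = (nmult m (w - u) + ?v) + (- ?v + w + ?v)"
    by (subst (2) nmult_Suc_left) (simp add: group_expand del: add_uminus_conv_diff)
  moreover have "N (nmult m (w - u) + ?v) \<le> real m * (2 * growth * N w)"
    using Suc by simp
  moreover have "N (- ?v + w + ?v) \<le> 2 * growth * N w"
    using Suc(2)[of m] assms(2) by (intro conj_le) auto
  ultimately show ?case
    using triangle[of "nmult m (w - u) + ?v" "- ?v + w + ?v"] by (simp add: algebra_simps)
qed simp

text \<open>
  Doubling is locally injective with a Lipschitz inverse. Put \<open>f = g + u\<close> and let \<open>w\<close> be the
  difference \<open>- (g + g) + (f + f)\<close>, so that conjugation by \<open>g\<close> takes \<open>u\<close> to \<open>w - u\<close>. If \<open>w\<close>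
  is much smaller than \<open>u\<close>, then conjugation by \<open>g\<close> nearly inverts \<open>v = m u\<close> as well, where \<open>v\<close> has
  size comparable to a fixed \<open>s\<close>. As \<open>g\<close> is close to the identity, \<open>v\<close> is nearly its own
  inverse, against the linear growth of its multiples.
\<close>

lemma doubling_inverse_Lipschitz:
  obtains \<eta> C where "0 < \<eta>" "0 < C"
    "\<And>g f. N g < \<eta> \<Longrightarrow> N f < \<eta> \<Longrightarrow> N (- g + f) \<le> C * N (- (g + g) + (f + f))"
proof -
  define G where "G = growth"
  have G: "0 < G" using growth_pos by (simp add: G_def)
  define s where "s = r / 8"
  have s: "0 < s" using r_pos by (simp add: s_def)
  define \<eta> where "\<eta> = min (s / 4) (s / (2 * G * (1 + 2 * G)))"
  have "0 < \<eta>" using s G by (simp add: \<eta>_def)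
  moreover have "\<eta> \<le> s / 4" unfolding \<eta>_def by (rule min.cobounded1)
  ultimately have \<eta>: "0 < \<eta>" "\<eta> \<le> s / 4" .
  have \<eta>G: "G * ((1 + 2 * G) * x) \<le> s / 2" if "x < \<eta>" for x
  proof -
    have "x \<le> s / (2 * G * (1 + 2 * G))" using that by (simp add: \<eta>_def)
    then have "x * (2 * G * (1 + 2 * G)) \<le> s" using G by (subst (asm) pos_le_divide_eq) auto
    then show ?thesis by (simp add: algebra_simps)
  qed
  have "N (- g + f) \<le> 4 * G ^ 3 * N (- (g + g) + (f + f))" if gf: "N g < \<eta>" "N f < \<eta>" for g f
  proof (cases "- g + f = 0")
    case True
    then show ?thesis using G by simp
  next
    case False
    define u where "u = - g + f"
    define w where "w = - g + u + g + u"
    have w: "- (g + g) + (f + f) = w"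
      by (simp add: w_def u_def group_expand del: add_uminus_conv_diff)
    have u: "N u < s / 2" "u \<noteq> 0"
      using triangle[of "- g" f] norm_uminus[of g] gf \<eta> False by (auto simp: u_def)
    have Nw: "N w < r / 4"
      using triangle[of "- g + u + g" u] triangle3[of "- g" u g] norm_uminus[of g] gf \<eta> u(1)
      by (simp add: w_def s_def)
    obtain m where m: "\<And>j. j \<le> m \<Longrightarrow> N (nmult j u) < s" "s / 2 \<le> N (nmult m u)"
      using exists_escape_time[OF u(2,1)] r_pos by (auto simp: s_def)
    have "m \<noteq> 0" using m(2) s by (cases m) auto
    define v where "v = nmult m u"
    have v: "s / 2 \<le> N v" "N v < s" using m by (auto simp: v_def)
    have mu: "real m * N u \<le> G * s"
    proof -
      have "real m * N u \<le> G * N v"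
        unfolding G_def v_def by (rule linear_growth) (use m(1) r_pos in \<open>fastforce simp: s_def\<close>)
      also have "\<dots> \<le> G * s" using v(2) G by simp
      finally show ?thesis .
    qed
    have v2: "s \<le> G * N (v + v)"
    proof -
      have "real 2 * N v \<le> G * N (nmult 2 v)"
        unfolding G_def
      proof (rule linear_growth)
        fix j :: nat assume "j \<le> 2"
        then have "real j * N v \<le> 2 * N v" by (intro mult_right_mono) auto
        then show "N (nmult j v) < r / 2"
          using nmult_le[of j v] v(2) r_pos by (simp add: s_def)
      qed
      then show ?thesis using v(1) by (simp add: numeral_2_eq_2)
    qed
    define W where "W = nmult m (w - u) + nmult m u"
    have NW: "N W \<le> real m * (2 * G * N w)"
      unfolding W_def G_def
      by (rule nmult_diff_nmult_le) (use m(1) r_pos Nw in \<open>fastforce simp: s_def\<close>)+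
    have "w - u = - g + u + g" by (simp add: w_def)
    then have "W = - g + v + g + v" by (simp add: W_def nmult_conj v_def)
    then have "v + v = g + W + (- v + - g + v)"
      by (simp add: group_expand del: add_uminus_conv_diff)
    then have "N (v + v) \<le> N g + N W + N (- v + - g + v)"
      using triangle3[of g W "- v + - g + v"] by simp
    also have "N (- v + - g + v) \<le> 2 * G * N g"
      using conj_le[of v "- g"] v(2) gf(1) \<eta> r_pos by (simp add: norm_uminus s_def G_def)
    finally have "N (v + v) \<le> (1 + 2 * G) * N g + N W" by (simp add: algebra_simps)
    then have "G * N (v + v) \<le> G * ((1 + 2 * G) * N g) + G * N W"
      using G by (simp flip: distrib_left)
    then have "s / 2 \<le> G * N W" using v2 \<eta>G[OF gf(1)] by linarith
    also have "\<dots> \<le> G * (real m * (2 * G * N w))" using NW G by simp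
    finally have "s \<le> 4 * G * G * N w * real m" by (simp add: algebra_simps)
    then have "G * s \<le> G * (4 * G * G * N w * real m)" using G by simp
    then have "real m * N u \<le> real m * (4 * G ^ 3 * N w)"
      using mu by (simp add: power3_eq_cube algebra_simps)
    then show ?thesis using \<open>m \<noteq> 0\<close> by (simp add: w u_def)
  qed
  then show ?thesis using that[of \<eta> "4 * G ^ 3"] \<eta> G by simp
qed

end


section \<open>Completeness\<close>

lemma (in group_norm) conj_continuous:
  assumes "0 < e"
  obtains s where "0 < s" "\<And>x. N x < s \<Longrightarrow> N (- y + x + y) < e"
proof -
  have "((\<lambda>x. - y + x + y) \<longlongrightarrow> - y + 0 + y) (nhds 0)"
    by (intro tendsto_intros filterlim_ident)
  then have "\<forall>\<^sub>F x in nhds 0. N (- y + x + y) < e"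
    using assms unfolding tendsto_iff by simp
  then obtain S where S: "open S" "0 \<in> S" "\<And>x. x \<in> S \<Longrightarrow> N (- y + x + y) < e"
    unfolding eventually_nhds by blast
  then show ?thesis using that open_contains_ball[OF S(1,2)] by (metis add_0 minus_zero)
qed

text \<open>
  A completely metrisable group is complete in its two-sided uniformity. A complete metric
  \<open>\<rho>\<close> need not be invariant, but by the Baire category theorem some translate \<open>X i + y\<close> of a
  sequence that is Cauchy on both sides is Cauchy for \<open>\<rho>\<close>.
\<close>

lemma (in group_norm) two_sided_Cauchy_convergent:
  fixes X :: "nat \<Rightarrow> 'a"
  assumes "completely_metrizable_space (euclidean :: 'a topology)"
    and left: "\<And>e. 0 < e \<Longrightarrow> \<exists>n. \<forall>i\<ge>n. \<forall>j\<ge>n. N (- X i + X j) < e"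
    and right: "\<And>e. 0 < e \<Longrightarrow> \<exists>n. \<forall>i\<ge>n. \<forall>j\<ge>n. N (X i - X j) < e"
  obtains l where "X \<longlonglongrightarrow> l"
proof -
  obtain \<rho> where "Metric_space (UNIV :: 'a set) \<rho>" and cmp: "Metric_space.mcomplete UNIV \<rho>"
    and top: "euclidean = Metric_space.mtopology UNIV \<rho>"
    using assms(1) unfolding completely_metrizable_space_def
    by (metis Metric_space.topspace_mtopology topspace_euclidean)
  then interpret M: Metric_space UNIV \<rho> by simp
  define \<V> where "\<V> m = {V. open V \<and> (\<exists>k. \<forall>i\<ge>k. \<forall>j\<ge>k. \<forall>v\<in>V. \<rho> (X i + v) (X j + v) < 1 / Suc m)}" for m
  define D where "D m = \<Union> (\<V> m)" for m
  have "openin euclidean (D m) \<and> euclidean closure_of (D m) = topspace euclidean" for m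
  proof
    show "openin euclidean (D m)" unfolding D_def by (auto simp: \<V>_def)
    show "euclidean closure_of (D m) = topspace euclidean"
      unfolding dense_intersects_open
    proof (intro allI impI)
      fix T :: "'a set" assume "openin euclidean T \<and> T \<noteq> {}"
      then obtain y0 where T: "open T" "y0 \<in> T" by auto
      obtain a where a: "0 < a" "\<And>y. N (- y0 + y) < a \<Longrightarrow> y \<in> T"
        using open_contains_ball[OF T] by blast
      obtain b where b: "0 < b" "\<And>x. N x < b \<Longrightarrow> N (- y0 + x + y0) < a"
        using conj_continuous[OF a(1), of y0] by blast
      obtain k where k: "\<And>i j. i \<ge> k \<Longrightarrow> j \<ge> k \<Longrightarrow> N (- X i + X j) < b"
        using left[OF b(1)] by blast
      \<comment> \<open>The target \<open>z\<close> is fixed first; then \<open>y0\<close> is moved to a nearby \<open>y\<close> that a later \<open>X j\<close>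
        translates to exactly \<open>z\<close>. All further \<open>X i\<close> translate the vicinity of \<open>y\<close> into one
        fixed \<open>\<rho>\<close>-small ball around \<open>z\<close>.\<close>
      define z where "z = X k + y0"
      have "openin euclidean (M.mball z (1 / (2 * Suc m)))"
        unfolding top by (rule M.openin_mball)
      then have "open (M.mball z (1 / (2 * Suc m)))" by simp
      moreover have "z \<in> M.mball z (1 / (2 * Suc m))" by simp
      ultimately obtain c where c: "0 < c" "\<And>p. N (- z + p) < c \<Longrightarrow> p \<in> M.mball z (1 / (2 * Suc m))"
        using open_contains_ball by metis
      obtain s where s: "0 < s" "\<And>x. N x < s \<Longrightarrow> N (- z + x + z) < c / 2"
        using conj_continuous[of "c / 2" z] c(1) by auto
      obtain k' where k': "\<And>i j. i \<ge> k' \<Longrightarrow> j \<ge> k' \<Longrightarrow> N (X i - X j) < s"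
        using right[OF s(1)] by blast
      define j where "j = max k k'"
      define y where "y = - X j + z"
      define V where "V = {p. N (- y + p) < c / 2}"
      have near: "\<rho> z (X i + v) < 1 / (2 * Suc m)" if "i \<ge> j" "v \<in> V" for i v
      proof -
        have "- z + (X i + v) = (- z + (X i - X j) + z) + (- y + v)"
          by (simp add: y_def group_expand del: add_uminus_conv_diff)
        moreover have "N (- z + (X i - X j) + z) < c / 2"
          using that(1) by (intro s(2) k') (auto simp: j_def)
        moreover have "N (- y + v) < c / 2" using that(2) by (simp add: V_def)
        ultimately have "N (- z + (X i + v)) < c"
          using triangle[of "- z + (X i - X j) + z" "- y + v"] by simp
        then show ?thesis using c(2) by simp
      qed
      have "V \<in> \<V> m"
        unfolding \<V>_def
      proof (intro CollectI conjI exI[of _ j] allI impI ballI)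
        show "open V" unfolding V_def by (rule open_ball)
        fix i i' v assume "i \<ge> j" "i' \<ge> j" "v \<in> V"
        then have "\<rho> z (X i + v) < 1 / (2 * Suc m)" "\<rho> z (X i' + v) < 1 / (2 * Suc m)"
          using near by blast+
        moreover have "1 / (2 * real (Suc m)) + 1 / (2 * real (Suc m)) = 1 / Suc m"
          by (simp add: field_simps)
        ultimately show "\<rho> (X i + v) (X i' + v) < 1 / Suc m"
          using M.triangle[of "X i + v" z "X i' + v"] M.commute[of "X i + v" z] by simp
      qed
      moreover have "y \<in> V" using c(1) by (simp add: V_def)
      moreover have "y \<in> T"
      proof (rule a(2))
        have "- y0 + y = - y0 + (- X j + X k) + y0" by (simp add: y_def z_def add.assoc)
        then show "N (- y0 + y) < a" using b(2)[of "- X j + X k"] k[of j k] by (simp add: j_def)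
      qed
      ultimately show "D m \<inter> T \<noteq> {}" unfolding D_def by blast
    qed
  qed
  then have "euclidean closure_of (\<Inter> (range D)) = topspace (euclidean :: 'a topology)"
    using assms(1) by (intro Baire_category) auto
  then obtain y where "y \<in> \<Inter> (range D)"
    by (metis closure_of_empty ex_in_conv topspace_euclidean UNIV_not_empty)
  then have y: "y \<in> D m" for m by blast
  have "M.MCauchy (\<lambda>i. X i + y)"
    unfolding M.MCauchy_def
  proof (intro conjI allI impI)
    fix e :: real assume "e > 0"
    then obtain m where m: "1 / Suc m < e" using nat_approx_posE by blast
    obtain k where "\<forall>i\<ge>k. \<forall>j\<ge>k. \<rho> (X i + y) (X j + y) < 1 / Suc m"
      using y[of m] unfolding D_def \<V>_def by blast
    then show "\<exists>k. \<forall>i j. k \<le> i \<longrightarrow> k \<le> j \<longrightarrow> \<rho> (X i + y) (X j + y) < e"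
      using m by (meson less_trans)
  qed simp
  then obtain p where "(\<lambda>i. X i + y) \<longlonglongrightarrow> p"
    using cmp unfolding M.mcomplete_def top[symmetric] by auto
  then have "(\<lambda>i. X i + y - y) \<longlonglongrightarrow> p - y" by (intro tendsto_intros)
  then show ?thesis using that by simp
qed


section \<open>Roots\<close>

text \<open>
  Approximate halves of \<open>f\<close> form a left Cauchy sequence because doubling has a Lipschitz inverse,
  and a right Cauchy sequence because conjugation by small elements is Lipschitz.
\<close>

lemma (in gleason_norm) exists_half:
  assumes complete: "completely_metrizable_space (euclidean :: 'a topology)"
    and dense: "\<And>W :: 'a set. open W \<Longrightarrow> 0 \<in> W \<Longrightarrow> 0 \<in> interior (closure {g + g | g. g \<in> W})"
    and "0 < e"
  obtains \<delta> where "0 < \<delta>" "\<And>f. N f < \<delta> \<Longrightarrow> \<exists>g. g + g = f \<and> N g \<le> e"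
proof -
  obtain \<eta> C where \<eta>: "0 < \<eta>" "0 < C"
    and lip: "\<And>g f. N g < \<eta> \<Longrightarrow> N f < \<eta> \<Longrightarrow> N (- g + f) \<le> C * N (- (g + g) + (f + f))"
    using doubling_inverse_Lipschitz by blast
  define s where "s = min e (min \<eta> (r / 8))"
  have s: "0 < s" "s \<le> e" "s \<le> \<eta>" "s \<le> r / 8" using assms(3) \<eta> r_pos by (auto simp: s_def)
  define S where "S = {g + g | g. g \<in> {x. N x < s}}"
  have "0 \<in> interior (closure S)"
    unfolding S_def using s(1) by (intro dense open_ball0) auto
  then obtain \<delta> where \<delta>: "0 < \<delta>" "\<And>f. N (- 0 + f) < \<delta> \<Longrightarrow> f \<in> interior (closure S)"
    using open_contains_ball[OF open_interior] by metis
  have "\<exists>g. g + g = f \<and> N g \<le> e" if "N f < \<delta>" for f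
  proof -
    have f: "f \<in> closure S" using \<delta>(2)[of f] that interior_subset by auto
    have "\<exists>g. N g < s \<and> N (- f + (g + g)) < 1 / Suc n" for n
    proof -
      have "f \<in> {x. N (- f + x) < 1 / Suc n}" by simp
      then have "{x. N (- f + x) < 1 / Suc n} \<inter> S \<noteq> {}"
        using f open_Int_closure_eq_empty[OF open_ball, of f "1 / Suc n" S] by blast
      then show ?thesis unfolding S_def by blast
    qed
    then obtain X where X: "\<And>n. N (X n) < s" "\<And>n. N (- f + (X n + X n)) < 1 / Suc n"
      by metis
    have inv_lim: "\<exists>n. \<forall>i\<ge>n. \<forall>j\<ge>n. b * (1 / Suc i + 1 / Suc j) < a"
      if "0 < a" "0 < b" for a b :: real
    proof -
      obtain n where n: "1 / Suc n < a / (2 * b)"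
        using nat_approx_posE[of "a / (2 * b)"] \<open>0 < a\<close> \<open>0 < b\<close> by auto
      have "b * (1 / Suc i + 1 / Suc j) < a" if "i \<ge> n" "j \<ge> n" for i j
      proof -
        have "1 / Suc i \<le> 1 / Suc n" "1 / Suc j \<le> 1 / Suc n"
          using that by (simp_all add: field_simps)
        then have "1 / Suc i + 1 / Suc j < a / b" using n by simp
        then show ?thesis using \<open>0 < b\<close> by (simp add: field_simps)
      qed
      then show ?thesis by blast
    qed
    have left: "N (- X i + X j) \<le> C * (1 / Suc i + 1 / Suc j)" for i j
    proof -
      have "N (- X i + X j) \<le> C * N (- (X i + X i) + (X j + X j))"
        using X(1)[of i] X(1)[of j] s by (intro lip) linarith+
      also have "\<dots> \<le> C * (1 / Suc i + 1 / Suc j)"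
      proof (rule mult_left_mono)
        show "N (- (X i + X i) + (X j + X j)) \<le> 1 / Suc i + 1 / Suc j"
          using triangle_diff[of "X i + X i" "X j + X j" f] norm_diff_commute'[of f "X i + X i"]
            X(2)[of i] X(2)[of j] by linarith
      qed (use \<eta> in simp)
      finally show ?thesis .
    qed
    have right: "N (X j - X i) \<le> 2 * growth * C * (1 / Suc i + 1 / Suc j)" for i j
    proof -
      have "N (- (- X i) + (- X i + X j) + - X i) \<le> 2 * growth * N (- X i + X j)"
        using X(1)[of i] X(1)[of j] s(1,4) triangle[of "- X i" "X j"]
        by (intro conj_le) (simp_all add: norm_uminus)
      also have "\<dots> \<le> 2 * growth * (C * (1 / Suc i + 1 / Suc j))"
        using left growth_pos by (intro mult_left_mono) auto
      finally show ?thesis by (simp add: mult.assoc)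
    qed
    obtain g where g: "X \<longlonglongrightarrow> g"
    proof (rule two_sided_Cauchy_convergent[OF complete, of X])
      fix a :: real assume a: "0 < a"
      show "\<exists>n. \<forall>i\<ge>n. \<forall>j\<ge>n. N (- X i + X j) < a"
        using inv_lim[OF a \<eta>(2)] left by (meson le_less_trans)
      have "0 < 2 * growth * C" using growth_pos \<eta>(2) by simp
      then show "\<exists>n. \<forall>i\<ge>n. \<forall>j\<ge>n. N (X i - X j) < a"
        using inv_lim[OF a] right by (meson le_less_trans)
    qed
    have "(\<lambda>n. X n + X n) \<longlonglongrightarrow> f"
      unfolding tendsto_iff
    proof (intro allI impI)
      fix a :: real assume "a > 0"
      then obtain n where n: "1 / Suc n < a" using nat_approx_posE by blast
      have "N (- f + (X i + X i)) < a" if "i \<ge> n" for i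
      proof -
        have "1 / Suc i \<le> 1 / Suc n" using that by (simp add: field_simps)
        then show ?thesis using X(2)[of i] n by linarith
      qed
      then show "\<forall>\<^sub>F i in sequentially. N (- f + (X i + X i)) < a"
        unfolding eventually_sequentially by blast
    qed
    moreover have "(\<lambda>n. X n + X n) \<longlonglongrightarrow> g + g" by (intro tendsto_intros g)
    ultimately have "g + g = f" using limit_unique trivial_limit_sequentially by blast
    moreover have "N g \<le> s"
      by (rule LIMSEQ_le_const2[OF tendsto_norm[OF g]]) (use X(1) less_imp_le in blast)
    ultimately show ?thesis using s(2) by (intro exI[of _ g]) simp
  qed
  then show ?thesis using that \<delta>(1) by blast
qed

text \<open>
  Halving can be iterated: if all multiples of \<open>y\<close> up to \<open>2 ^ n y = f\<close> are small, linear growth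
  bounds them by \<open>growth * N f\<close>, and adding one small half of \<open>y\<close> to them keeps them within the
  range in which linear growth applies.
\<close>

lemma (in gleason_norm) exists_dyadic_roots:
  assumes half: "\<And>f. N f < \<delta> \<Longrightarrow> \<exists>g. g + g = f \<and> N g \<le> r / 4"
    and f: "N f < r / 2" "growth * N f < \<delta>" "growth * N f < r / 4"
  obtains y where "y 0 = f" "\<And>n. y (Suc n) + y (Suc n) = y n"
    "\<And>n. N (y n) \<le> growth * N f / 2 ^ n"
proof -
  define P where "P n y \<longleftrightarrow> nmult (2 ^ n) y = f \<and> (\<forall>j\<le>2 ^ n. N (nmult j y) < r / 2)" for n y
  have bound: "2 ^ n * N y \<le> growth * N f" if "P n y" for n y
    using linear_growth[of "2 ^ n" y] that by (simp add: P_def)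
  have "\<exists>y. \<forall>n. P n (y n) \<and> y (Suc n) + y (Suc n) = y n"
  proof (rule dependent_nat_choice)
    have "N (nmult j f) < r / 2" if "j \<le> 1" for j
      using that f(1) r_pos by (cases j) auto
    then show "\<exists>y. P 0 y" by (intro exI[of _ f]) (simp add: P_def)
  next
    fix y n assume y: "P n y"
    have "N y \<le> 2 ^ n * N y" using mult_right_mono[of 1 "2 ^ n" "N y"] by simp
    then obtain z where z: "z + z = y" "N z \<le> r / 4" using half[of y] bound[OF y] f(2) by auto
    have "N (nmult j z) < r / 2" if j: "j \<le> 2 ^ Suc n" for j
    proof -
      define a b where "a = j div 2" and "b = j mod 2"
      have jab: "j = 2 * a + b" and b: "b \<le> 1" by (auto simp: a_def b_def)
      have a: "a \<le> 2 ^ n" using j by (simp add: a_def)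
      have "N (nmult j z) \<le> N (nmult a y) + N (nmult b z)"
        using triangle[of "nmult (2 * a) z" "nmult b z"] z(1) by (simp add: jab nmult_add nmult_double)
      moreover have "N (nmult a y) \<le> 2 ^ n * N y"
      proof -
        have "real a \<le> real (2 ^ n)" using a by (simp only: of_nat_le_iff)
        then have "real a * N y \<le> 2 ^ n * N y" by (intro mult_right_mono) auto
        then show ?thesis using nmult_le[of a y] by linarith
      qed
      moreover have "N (nmult b z) \<le> r / 4" using b z(2) r_pos by (cases b) auto
      ultimately show ?thesis using bound[OF y] f(3) by linarith
    qed
    moreover have "nmult (2 ^ Suc n) z = f" using y z(1) by (simp add: P_def nmult_double)
    ultimately show "\<exists>z. P (Suc n) z \<and> z + z = y" using z(1) by (auto simp: P_def)
  qed
  then obtain y where y: "\<And>n. P n (y n)" "\<And>n. y (Suc n) + y (Suc n) = y n" by blast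
  show ?thesis
  proof (rule that[of y])
    show "y 0 = f" using y(1)[of 0] by (simp add: P_def)
    show "N (y n) \<le> growth * N f / 2 ^ n" for n
      using bound[OF y(1)[of n]] by (simp add: field_simps)
  qed (rule y(2))
qed


section \<open>One-parameter subgroups\<close>

lemma one_parameter_subgroup_imult:
  assumes "one_parameter_subgroup h"
  shows "h (of_int k * a) = imult k (h a)"
proof -
  have add: "h (a + b) = h a + h b" for a b
    using assms by (simp add: one_parameter_subgroup_def)
  have "h 0 + h 0 = h 0 + 0" using add[of 0 0] by simp
  then have h0: "h 0 = 0" by (rule add_left_imp_eq)
  have minus: "h (- a) = - h a" for a
    using add[of "- a" a] h0 by (simp add: eq_neg_iff_add_eq_0)
  have nat: "h (real n * a) = nmult n (h a)" for n
    by (induction n) (auto simp: h0 distrib_right add add.commute[of a])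
  show ?thesis
    using nat[of "nat k"] nat[of "nat (- k)"] minus[of "real (nat (- k)) * a"]
    by (auto simp: imult_def)
qed

lemma (in group_norm) one_parameter_subgroup_unique:
  fixes h h' :: "real \<Rightarrow> 'a"
  assumes h: "one_parameter_subgroup h" "one_parameter_subgroup h'" "h 1 = h' 1"
    and in_S: "\<And>\<alpha>. \<alpha> \<in> {-1..1} \<Longrightarrow> h \<alpha> \<in> S" "\<And>\<alpha>. \<alpha> \<in> {-1..1} \<Longrightarrow> h' \<alpha> \<in> S"
    and inj: "\<And>f g. f \<in> S \<Longrightarrow> g \<in> S \<Longrightarrow> f + f = g + g \<Longrightarrow> f = g"
  shows "h = h'"
proof
  fix \<alpha> :: real
  have dyadic: "h (1 / 2 ^ n) = h' (1 / 2 ^ n)" for n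
  proof (induction n)
    case (Suc n)
    have mem: "(1 / 2 ^ Suc n :: real) \<in> {-1..1}"
      using one_le_power[of "2::real" "Suc n"] by (auto simp: field_simps)
    have double: "k (1 / 2 ^ Suc n) + k (1 / 2 ^ Suc n) = k (1 / 2 ^ n)" if "one_parameter_subgroup k" for k
    proof -
      have "k (1 / 2 ^ Suc n + 1 / 2 ^ Suc n) = k (1 / 2 ^ Suc n) + k (1 / 2 ^ Suc n)"
        using that unfolding one_parameter_subgroup_def by blast
      then show ?thesis by simp
    qed
    show ?case
    proof (rule inj)
      show "h (1 / 2 ^ Suc n) \<in> S" "h' (1 / 2 ^ Suc n) \<in> S" using mem by (rule in_S)+
      show "h (1 / 2 ^ Suc n) + h (1 / 2 ^ Suc n) = h' (1 / 2 ^ Suc n) + h' (1 / 2 ^ Suc n)"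
        unfolding double[OF h(1)] double[OF h(2)] by (rule Suc)
    qed
  qed (use h(3) in simp)
  define a where "a n = of_int \<lfloor>2 ^ n * \<alpha>\<rfloor> * (1 / 2 ^ n :: real)" for n :: nat
  have eq: "h (a n) = h' (a n)" for n
    unfolding a_def one_parameter_subgroup_imult[OF h(1)] one_parameter_subgroup_imult[OF h(2)]
    by (simp add: dyadic)
  have "a \<longlonglongrightarrow> \<alpha>"
  proof (rule real_tendsto_sandwich)
    show "(\<lambda>n. \<alpha> - (1/2) ^ n) \<longlonglongrightarrow> \<alpha>"
      using tendsto_diff[OF tendsto_const[of \<alpha>] LIMSEQ_power_zero[of "1/2::real"]] by simp
    show "(\<lambda>n. \<alpha>) \<longlonglongrightarrow> \<alpha>" by simp
    have "\<alpha> - (1/2) ^ n \<le> a n \<and> a n \<le> \<alpha>" for n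
    proof -
      have "2 ^ n * \<alpha> - 1 \<le> of_int \<lfloor>2 ^ n * \<alpha>\<rfloor>" "of_int \<lfloor>2 ^ n * \<alpha>\<rfloor> \<le> 2 ^ n * \<alpha>" by linarith+
      then have "(2 ^ n * \<alpha> - 1) / 2 ^ n \<le> a n" "a n \<le> (2 ^ n * \<alpha>) / 2 ^ n"
        unfolding a_def times_divide_eq_right mult_1_right by (intro divide_right_mono; simp)+
      then show ?thesis by (simp add: diff_divide_distrib power_one_over)
    qed
    then show "\<forall>\<^sub>F n in sequentially. \<alpha> - (1/2) ^ n \<le> a n" "\<forall>\<^sub>F n in sequentially. a n \<le> \<alpha>"
      by auto
  qed
  then have "(\<lambda>n. h (a n)) \<longlonglongrightarrow> h \<alpha>" "(\<lambda>n. h' (a n)) \<longlonglongrightarrow> h' \<alpha>"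
    using h(1,2) unfolding one_parameter_subgroup_def
    by (auto intro: continuous_on_tendsto_compose)
  then show "h \<alpha> = h' \<alpha>" unfolding eq using limit_unique trivial_limit_sequentially by blast
qed

text \<open>
  With \<open>y n\<close> in the role of \<open>h (1 / 2 ^ n)\<close>, the value \<open>h \<alpha>\<close> is the limit of the multiples
  \<open>\<lfloor>2 ^ n \<alpha>\<rfloor> y n\<close>.
\<close>

lemma (in group_norm) one_parameter_subgroup_of_dyadic_roots:
  assumes complete: "completely_metrizable_space (euclidean :: 'a topology)"
    and root: "\<And>n. y (Suc n) + y (Suc n) = y n"
    and bound: "\<And>n. N (y n) \<le> c / 2 ^ n"
  obtains h where "one_parameter_subgroup h" "h 1 = y 0" "\<And>\<alpha>. N (h \<alpha>) \<le> c * \<bar>\<alpha>\<bar>"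
proof -
  have c: "0 \<le> c" using order_trans[OF nonneg bound[of 0]] by simp
  define A where "A n \<alpha> = imult \<lfloor>2 ^ n * \<alpha>\<rfloor> (y n)" for n and \<alpha> :: real
  have refine: "imult k (y n) = imult (2 ^ m * k) (y (n + m))" for k n m
  proof (induction m)
    case (Suc m)
    then show ?case
      using imult_double[of "2 ^ m * k" "y (n + Suc m)"] root[of "n + m"] by (simp add: mult.assoc)
  qed simp
  have imult_bound: "N (imult k (y n)) \<le> \<bar>of_int k\<bar> * c / 2 ^ n" for k n
    using imult_le[of k "y n"] mult_left_mono[OF bound[of n], of "\<bar>of_int k\<bar>"] by simp
  have close: "N (imult (2 ^ m * \<lfloor>2 ^ n * \<alpha>\<rfloor> - \<lfloor>2 ^ (n + m) * \<alpha>\<rfloor>) (y (n + m))) \<le> c / 2 ^ n"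
    for n m and \<alpha> :: real
  proof -
    let ?k = "2 ^ m * \<lfloor>2 ^ n * \<alpha>\<rfloor> - \<lfloor>2 ^ (n + m) * \<alpha>\<rfloor>"
    have "\<bar>of_int ?k\<bar> \<le> (2 ^ m :: real)"
    proof -
      define t :: real where "t = 2 ^ n * \<alpha>"
      have "2 ^ m * (t - 1) \<le> 2 ^ m * of_int \<lfloor>t\<rfloor>" "2 ^ m * of_int \<lfloor>t\<rfloor> \<le> 2 ^ m * t"
        by (intro mult_left_mono; linarith?; simp)+
      then have "2 ^ m * t - 2 ^ m \<le> 2 ^ m * of_int \<lfloor>t\<rfloor>" "2 ^ m * of_int \<lfloor>t\<rfloor> \<le> 2 ^ m * t"
        by (simp_all add: right_diff_distrib)
      moreover have "2 ^ m * t - 1 < of_int \<lfloor>2 ^ m * t\<rfloor>" "of_int \<lfloor>2 ^ m * t\<rfloor> \<le> 2 ^ m * t"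
        by linarith+
      moreover have "(1::real) \<le> 2 ^ m" by simp
      moreover have "of_int ?k = 2 ^ m * of_int \<lfloor>t\<rfloor> - (of_int \<lfloor>2 ^ m * t\<rfloor> :: real)"
        by (simp add: t_def power_add algebra_simps)
      ultimately show ?thesis by linarith
    qed
    then have "\<bar>of_int ?k\<bar> * c / 2 ^ (n + m) \<le> 2 ^ m * c / 2 ^ (n + m)"
      using c by (intro divide_right_mono mult_right_mono) auto
    then show ?thesis using imult_bound[of ?k "n + m"] by (simp add: power_add)
  qed
  have diff: "N (- A i \<alpha> + A j \<alpha>) \<le> c / 2 ^ n \<and> N (A i \<alpha> - A j \<alpha>) \<le> c / 2 ^ n"
    if ij: "n \<le> i" "i \<le> j" for i j n \<alpha>
  proof -
    define m where "m = j - i"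
    have j: "j = i + m" using ij by (simp add: m_def)
    define k l where "k = 2 ^ m * \<lfloor>2 ^ i * \<alpha>\<rfloor>" and "l = \<lfloor>2 ^ j * \<alpha>\<rfloor>"
    have Ai: "A i \<alpha> = imult k (y j)" using refine[of _ i m] by (simp add: A_def j k_def)
    have Aj: "A j \<alpha> = imult l (y j)" by (simp add: A_def l_def)
    have "- A i \<alpha> + A j \<alpha> = - imult (k - l) (y j)"
      by (simp add: Ai Aj imult_uminus[symmetric] imult_add[symmetric])
    moreover have "A i \<alpha> - A j \<alpha> = imult (k - l) (y j)"
      using imult_add[of k "- l" "y j"] by (simp add: Ai Aj imult_uminus)
    moreover have "N (imult (k - l) (y j)) \<le> c / 2 ^ i"
      using close[of m i \<alpha>] by (simp add: k_def l_def j)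
    moreover have "c / 2 ^ i \<le> c / 2 ^ n"
      using c ij(1) by (intro divide_left_mono) (auto intro: power_increasing)
    ultimately show ?thesis by (simp add: norm_uminus)
  qed
  have c_lim: "(\<lambda>n. c / 2 ^ n) \<longlonglongrightarrow> 0"
    using tendsto_mult[OF tendsto_const[of c] LIMSEQ_power_zero[of "1/2::real"]]
    by (simp add: power_one_over)
  have "\<exists>l. (\<lambda>n. A n \<alpha>) \<longlonglongrightarrow> l" for \<alpha>
  proof -
    have Cauchy: "\<exists>n. \<forall>i\<ge>n. \<forall>j\<ge>n. N (- A i \<alpha> + A j \<alpha>) < e \<and> N (A i \<alpha> - A j \<alpha>) < e"
      if e: "0 < e" for e
    proof -
      obtain n where n: "c / 2 ^ n < e"
        using order_tendstoD(2)[OF c_lim e] unfolding eventually_sequentially by blast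
      have "N (- A i \<alpha> + A j \<alpha>) < e \<and> N (A i \<alpha> - A j \<alpha>) < e" if "i \<ge> n" "j \<ge> n" for i j
      proof (cases "i \<le> j")
        case True
        then show ?thesis using diff[of n i j \<alpha>] that n by linarith
      next
        case False
        then show ?thesis
          using diff[of n j i \<alpha>] that n norm_diff_commute[of "A i \<alpha>" "A j \<alpha>"]
            norm_diff_commute'[of "A i \<alpha>" "A j \<alpha>"] by linarith
      qed
      then show ?thesis by blast
    qed
    show ?thesis
    proof (rule two_sided_Cauchy_convergent[OF complete, of "\<lambda>n. A n \<alpha>"])
      fix e :: real assume "0 < e"
      then show "\<exists>n. \<forall>i\<ge>n. \<forall>j\<ge>n. N (- A i \<alpha> + A j \<alpha>) < e"
        "\<exists>n. \<forall>i\<ge>n. \<forall>j\<ge>n. N (A i \<alpha> - A j \<alpha>) < e"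
        using Cauchy by meson+
    qed blast
  qed
  then obtain h where h: "\<And>\<alpha>. (\<lambda>n. A n \<alpha>) \<longlonglongrightarrow> h \<alpha>" by metis
  have add: "h (\<alpha> + \<beta>) = h \<alpha> + h \<beta>" for \<alpha> \<beta>
  proof -
    have "(\<lambda>n. - (A n \<alpha> + A n \<beta>) + A n (\<alpha> + \<beta>)) \<longlonglongrightarrow> - (h \<alpha> + h \<beta>) + h (\<alpha> + \<beta>)"
      by (intro tendsto_intros h)
    moreover have "N (- (A n \<alpha> + A n \<beta>) + A n (\<alpha> + \<beta>)) \<le> c / 2 ^ n" for n
    proof -
      define k where "k = \<lfloor>2 ^ n * (\<alpha> + \<beta>)\<rfloor> - (\<lfloor>2 ^ n * \<alpha>\<rfloor> + \<lfloor>2 ^ n * \<beta>\<rfloor>)"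
      have "- (A n \<alpha> + A n \<beta>) + A n (\<alpha> + \<beta>) = imult k (y n)"
        by (simp add: A_def k_def imult_add[symmetric] imult_uminus[symmetric] del: minus_add_distrib)
      moreover have "\<bar>of_int k\<bar> * c \<le> 1 * c"
      proof (rule mult_right_mono)
        have "\<bar>k\<bar> \<le> 1" unfolding k_def distrib_left by linarith
        then show "\<bar>of_int k\<bar> \<le> (1::real)" by linarith
      qed (rule c)
      then have "\<bar>of_int k\<bar> * c / 2 ^ n \<le> 1 * c / 2 ^ n" by (rule divide_right_mono) simp
      ultimately show ?thesis using imult_bound[of k n] by simp
    qed
    ultimately have "N (- (h \<alpha> + h \<beta>) + h (\<alpha> + \<beta>)) \<le> 0"
      by (intro LIMSEQ_le[OF tendsto_norm c_lim]) auto
    then have "- (h \<alpha> + h \<beta>) + h (\<alpha> + \<beta>) = 0" using nonneg zero_iff by (metis antisym)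
    then show ?thesis by (metis add.right_neutral add_minus_cancel)
  qed
  have N_h: "N (h \<alpha>) \<le> c * \<bar>\<alpha>\<bar>" for \<alpha>
  proof -
    have lim: "(\<lambda>n. c * \<bar>\<alpha>\<bar> + c / 2 ^ n) \<longlonglongrightarrow> c * \<bar>\<alpha>\<bar>"
      using tendsto_add[OF tendsto_const[of "c * \<bar>\<alpha>\<bar>"] c_lim] by simp
    have "N (A n \<alpha>) \<le> c * \<bar>\<alpha>\<bar> + c / 2 ^ n" for n
    proof -
      have "\<bar>of_int \<lfloor>2 ^ n * \<alpha>\<rfloor>\<bar> \<le> \<bar>2 ^ n * \<alpha>\<bar> + 1" by linarith
      then have "\<bar>of_int \<lfloor>2 ^ n * \<alpha>\<rfloor>\<bar> * c / 2 ^ n \<le> (2 ^ n * \<bar>\<alpha>\<bar> + 1) * c / 2 ^ n"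
        using c by (intro divide_right_mono mult_right_mono) (auto simp: abs_mult)
      also have "\<dots> = c * \<bar>\<alpha>\<bar> + c / 2 ^ n" by (simp add: field_simps)
      finally show ?thesis using imult_bound[of "\<lfloor>2 ^ n * \<alpha>\<rfloor>" n] by (simp add: A_def)
    qed
    then show ?thesis by (intro LIMSEQ_le[OF tendsto_norm[OF h] lim]) auto
  qed
  have "h 0 + h 0 = h 0 + 0" using add[of 0 0] by simp
  then have h0: "h 0 = 0" by (rule add_left_imp_eq)
  have diff_h: "- h \<alpha> + h \<beta> = h (\<beta> - \<alpha>)" for \<alpha> \<beta>
    using add[of \<alpha> "\<beta> - \<alpha>"] by simp
  have "(h \<longlongrightarrow> h \<alpha>) (at \<alpha>)" for \<alpha>
    unfolding tendsto_iff diff_h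
  proof (intro allI impI)
    fix e :: real assume e: "e > 0"
    have "((\<lambda>\<beta>. c * \<bar>\<beta> - \<alpha>\<bar>) \<longlongrightarrow> c * \<bar>\<alpha> - \<alpha>\<bar>) (at \<alpha>)" by (intro tendsto_intros)
    then have "\<forall>\<^sub>F \<beta> in at \<alpha>. c * \<bar>\<beta> - \<alpha>\<bar> < e" using e order_tendstoD(2) by fastforce
    then show "\<forall>\<^sub>F \<beta> in at \<alpha>. N (h (\<beta> - \<alpha>)) < e"
      by eventually_elim (use N_h le_less_trans in blast)
  qed
  then have "one_parameter_subgroup h"
    unfolding one_parameter_subgroup_def continuous_on_def using add by auto
  moreover have "h 1 = y 0"
  proof -
    have "A n 1 = y 0" for n
      using refine[of 1 0 n] by (simp add: A_def imult_def)
    then have "(\<lambda>n. y 0) \<longlonglongrightarrow> h 1" using h[of 1] by simp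
    then show ?thesis using limit_unique[OF _ tendsto_const] trivial_limit_sequentially by blast
  qed
  ultimately show ?thesis using that N_h by blast
qed

theorem theorem19:
  assumes "completely_metrizable_space (euclidean :: 'a::topological_group_add topology)"
    and "\<exists>d :: 'a \<Rightarrow> 'a \<Rightarrow> real. minimal_metric d"
    and "\<And>W :: 'a set. open W \<Longrightarrow> 0 \<in> W \<Longrightarrow> 0 \<in> interior (closure {g + g | g. g \<in> W})"
  shows "\<exists>U V :: 'a set. open U \<and> open V \<and> V \<subseteq> U \<and> 0 \<in> V \<and>
           (\<forall>f\<in>V. \<exists>!h. one_parameter_subgroup h \<and> h 1 = f \<and> (\<forall>\<alpha>\<in>{-1..1}. h \<alpha> \<in> U))"
proof -
  obtain d :: "'a \<Rightarrow> 'a \<Rightarrow> real" and r K where "gleason_norm (d 0) r K"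
    using assms(2) minimal_metric_imp_gleason_norm by metis
  then interpret gleason_norm "d 0" r K .
  define N where "N = d 0"
  obtain \<eta> C where \<eta>: "0 < \<eta>"
    and lip: "\<And>g f. N g < \<eta> \<Longrightarrow> N f < \<eta> \<Longrightarrow> N (- g + f) \<le> C * N (- (g + g) + (f + f))"
    unfolding N_def using doubling_inverse_Lipschitz by metis
  obtain \<delta> where \<delta>: "0 < \<delta>" "\<And>f. N f < \<delta> \<Longrightarrow> \<exists>g. g + g = f \<and> N g \<le> r / 4"
    unfolding N_def using exists_half[OF assms(1,3), of "r / 4"] r_pos by auto
  define U where "U = {x. N x < \<eta>}"
  define t where "t = min \<eta> (min (r / 2) (min (r / 4) (min \<delta> \<eta>) / growth))"
  define V where "V = {x. N x < t}"
  have t: "0 < t" using \<eta> \<delta>(1) r_pos growth_pos by (simp add: t_def)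
  have inj: "f = g" if "f \<in> U" "g \<in> U" "f + f = g + g" for f g
  proof -
    have "N (- f + g) \<le> 0" using lip[of f g] that by (simp add: U_def N_def)
    then have "- f + g = 0" using zero_iff nonneg unfolding N_def by (metis antisym)
    then show ?thesis by (metis add.right_neutral add_minus_cancel)
  qed
  have "\<exists>!h. one_parameter_subgroup h \<and> h 1 = f \<and> (\<forall>\<alpha>\<in>{-1..1}. h \<alpha> \<in> U)" if "f \<in> V" for f
  proof -
    have f: "N f < t" using that by (simp add: V_def)
    then have "N f < min (r / 4) (min \<delta> \<eta>) / growth" "N f < r / 2" by (auto simp: t_def)
    then have gf: "growth * N f < min (r / 4) (min \<delta> \<eta>)" "N f < r / 2"
      using growth_pos by (auto simp: pos_less_divide_eq mult.commute)
    obtain y where y: "y 0 = f" "\<And>n. y (Suc n) + y (Suc n) = y n"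
      "\<And>n. N (y n) \<le> growth * N f / 2 ^ n"
      unfolding N_def
      by (rule exists_dyadic_roots[of \<delta> f]) (use gf \<delta>(2) in \<open>auto simp: N_def\<close>)
    obtain h where h: "one_parameter_subgroup h" "h 1 = y 0" "\<And>\<alpha>. N (h \<alpha>) \<le> growth * N f * \<bar>\<alpha>\<bar>"
      using one_parameter_subgroup_of_dyadic_roots[of y "growth * N f"] assms(1) y(2,3)
      unfolding N_def by metis
    have "h \<alpha> \<in> U" if "\<alpha> \<in> {-1..1}" for \<alpha>
    proof -
      have "growth * N f * \<bar>\<alpha>\<bar> \<le> growth * N f * 1"
        using that growth_pos nonneg[of f] by (intro mult_left_mono) (auto simp: N_def)
      then show ?thesis using h(3)[of \<alpha>] gf(1) by (simp add: U_def)
    qed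
    then have h': "one_parameter_subgroup h \<and> h 1 = f \<and> (\<forall>\<alpha>\<in>{-1..1}. h \<alpha> \<in> U)"
      using h(1,2) y(1) by simp
    show ?thesis
    proof (rule ex1I)
      fix k assume "one_parameter_subgroup k \<and> k 1 = f \<and> (\<forall>\<alpha>\<in>{-1..1}. k \<alpha> \<in> U)"
      then show "k = h"
        using h' inj by (intro one_parameter_subgroup_unique[of k h U]) simp_all
    qed (rule h')
  qed
  moreover have "open U" "open V" unfolding U_def V_def N_def by (rule open_ball0)+
  moreover have "V \<subseteq> U" by (auto simp: U_def V_def t_def)
  moreover have "0 \<in> V" using t by (simp add: V_def N_def)
  ultimately show ?thesis by (intro exI[of _ U] exI[of _ V] conjI ballI)
qed

end
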